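(* For every $n\ge 1$ there is a constant $c_n>0$ depending only on $n$ such that, for every cube $Q$ in $\mathbb{R}^n$, every measurable set $E\subset Q$, every weight $w$ in $\mathbb{R}^n$ and every $0<\varepsilon\le\frac12$, $$w(Q\setminus E)\,w(E)\le w(Q)\left(c_n\,\varepsilon\int_E\int_{Q\setminus E}\frac{(Mw(x))^{\frac{n-1+\varepsilon}{n}}}{|x-y|^{n+1-\varepsilon}}\,dy\,dx+c_n\,\varepsilon\int_{Q\setminus E}\int_E\frac{(Mw(x))^{\frac{n-1+\varepsilon}{n}}}{|x-y|^{n+1-\varepsilon}}\,dy\,dx\right)^{\frac{n}{n-1+\varepsilon}}.$$
   Context: A cube in $\mathbb{R}^n$ is a cartesian product of $n$ intervals of the same side length. A weight is a function $w\in L^1_{\mathrm{loc}}(\mathbb{R}^n)$ with $w(x)>0$ for a.e. $x$; $w(E)=\int_E w\,dx$. $M$ is the non-centered Hardy–Littlewood maximal function $Mf(x)=\sup_{R\ni x}\frac1{|R|}\int_R|f|\,dy$, the supremum over all cubes $R$ in $\mathbb{R}^n$ containing $x$. *)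

theory Defs
  imports "HOL-Analysis.Analysis"
begin

text \<open>
  The side intervals of a cube may be open, closed or half-open, independently in each
  coordinate; the side length is positive, so that averages over cubes make sense.
\<close>

definition is_cube :: "(real ^ 'n) set \<Rightarrow> bool" where
  "is_cube Q \<longleftrightarrow> (\<exists>I l. l > 0 \<and>
     (\<forall>i. is_interval (I i) \<and> emeasure lborel (I i) = ennreal l) \<and>
     Q = {x. \<forall>i. x $ i \<in> I i})"

definition is_weight :: "(real ^ 'n \<Rightarrow> real) \<Rightarrow> bool" where
  "is_weight w \<longleftrightarrow>
     (\<forall>K. compact K \<longrightarrow> w absolutely_integrable_on K) \<and> (AE x in lebesgue. w x > 0)"

definition weight_of :: "(real ^ 'n \<Rightarrow> real) \<Rightarrow> (real ^ 'n) set \<Rightarrow> ennreal" where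
  "weight_of w E = (\<integral>\<^sup>+x\<in>E. ennreal (w x) \<partial>lebesgue)"

definition maximal_fun :: "(real ^ 'n \<Rightarrow> real) \<Rightarrow> real ^ 'n \<Rightarrow> ennreal" where
  "maximal_fun f x =
     (SUP R\<in>{R. is_cube R \<and> x \<in> R}.
        (\<integral>\<^sup>+y\<in>R. ennreal \<bar>f y\<bar> \<partial>lebesgue) / emeasure lebesgue R)"

text \<open>Powers of extended nonnegative reals; only meant for positive exponents.\<close>

definition ennreal_powr :: "ennreal \<Rightarrow> real \<Rightarrow> ennreal" where
  "ennreal_powr t a = (if t = \<infinity> then \<infinity> else ennreal (enn2real t powr a))"

end

theory Submission
  imports Defs
begin

text \<open>
  Put \<open>p = (n - 1 + \<epsilon>) / n\<close> and \<open>q = 1 / p\<close>, and let \<open>E\<close> be whichever of the two sets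
  has at most half the Lebesgue measure of \<open>Q\<close>. Since the other factor is at most \<open>w(Q)\<close>, it is
  enough to bound \<open>w(E)\<close> by the \<open>q\<close>-th power of the energy whose outer variable runs over \<open>E\<close>.

  The unweighted core is a fractional relative isoperimetric inequality with the sharp factor
  \<open>\<epsilon>\<close> (lemma \<open>fractional_isoperimetric_cube\<close>): a cube \<open>P\<close> of side \<open>l\<close> that is split into \<open>A\<close> and \<open>B\<close>
  in comparable proportions satisfies
  \<open>l powr (n - 1 + \<epsilon>) \<le> C * \<epsilon> * (\<integral>\<integral> over A \<times> B of dist x y powr - (n + 1 - \<epsilon>))\<close>.
  The factor \<open>\<epsilon>\<close> comes from comparing scales. If \<open>x \<in> A\<close> and \<open>y \<in> B\<close>, then the midpoint of \<open>x\<close> and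
  \<open>y\<close> lies in \<open>A\<close> or in \<open>B\<close>, so it forms with one of the two points a separated pair at half
  the distance. Hence the part \<open>J(r)\<close> of the energy carried by pairs at distance at most \<open>r\<close>
  satisfies \<open>J(r) \<le> 2 powr \<epsilon> * J(r/2)\<close>: the energy loses only a factor \<open>2 powr - \<epsilon>\<close> per
  halving. Therefore \<open>m\<close> halvings remove at most the fraction \<open>1 - 2 powr (- \<epsilon> * m) \<le> \<epsilon> * m\<close> of
  the total energy; but they remove all pairs at distance comparable to \<open>l\<close>, and these
  contribute at least a fixed multiple of \<open>l powr (n - 1 + \<epsilon>)\<close>.

  The inequality is localised by a stopping time on dyadic subcubes of \<open>Q\<close>. Almost every point
  of \<open>E\<close> lies in dyadic cubes more than half filled by \<open>E\<close>, whereas \<open>Q\<close> itself is at most half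
  filled. At the last generation before the density first exceeds one half, the density is between
  \<open>2 ^ - (n + 1)\<close> and \<open>1/2\<close>. The maximal cubes with this property are disjoint and cover almost
  all of \<open>E\<close> (lemma \<open>balanced_cubes\<close>). On such a cube \<open>P\<close> the maximal function is at least
  \<open>w(P) / l ^ n\<close>, so multiplying the isoperimetric inequality by \<open>(w(P) / l ^ n) powr p\<close> bounds
  \<open>w(P) powr p\<close> by the energy between \<open>E \<inter> P\<close> and \<open>P - E\<close>. These energies add up to at most the
  energy between \<open>E\<close> and \<open>Q - E\<close>, and \<open>\<Sum> w(P) = \<Sum> (w(P) powr p) powr q\<close> is at most the
  \<open>q\<close>-th power of \<open>\<Sum> w(P) powr p\<close> because \<open>q \<ge> 1\<close>.
\<close>

section \<open>Pair interactions under halving of distances\<close>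

definition interaction :: "(real \<Rightarrow> ennreal) \<Rightarrow> (real ^ 'n) set \<Rightarrow> (real ^ 'n) set \<Rightarrow> ennreal" where
  "interaction k A B = (\<integral>\<^sup>+x\<in>A. (\<integral>\<^sup>+y\<in>B. k (dist x y) \<partial>lborel) \<partial>lborel)"

text \<open>
  For fixed \<open>x\<close> the map \<open>y \<mapsto> midpoint x y\<close> is a homothety of ratio one half.
\<close>

lemma nn_integral_midpoint:
  fixes f :: "real ^ 'n \<Rightarrow> ennreal"
  assumes [measurable]: "f \<in> borel_measurable borel"
  shows "(\<integral>\<^sup>+y. f (midpoint x y) \<partial>lborel) = 2 ^ CARD('n) * (\<integral>\<^sup>+z. f z \<partial>lborel)"
proof -
  let ?T = "\<lambda>y::real^'n. (1/2) *\<^sub>R x + (1/2) *\<^sub>R y"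
  have cancel: "2 ^ CARD('n) * ennreal ((1/2) ^ CARD('n)) = 1"
  proof -
    have "2 ^ CARD('n) * ennreal ((1/2) ^ CARD('n)) = ennreal (2 ^ CARD('n) * (1/2) ^ CARD('n))"
      by (simp add: ennreal_mult ennreal_power[symmetric])
    then show ?thesis
      by (simp add: power_mult_distrib[symmetric])
  qed
  have "(\<integral>\<^sup>+z. f z \<partial>lborel) =
      (\<integral>\<^sup>+z. f z \<partial>density (distr lborel borel ?T) (\<lambda>_. ennreal ((1/2) ^ CARD('n))))"
    by (subst lborel_affine[of "1/2" "(1/2) *\<^sub>R x"]) (simp_all add: ennreal_power)
  also have "\<dots> = ennreal ((1/2) ^ CARD('n)) * (\<integral>\<^sup>+y. f (?T y) \<partial>lborel)"
    by (simp add: nn_integral_density nn_integral_distr nn_integral_cmult)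
  also have "(\<lambda>y. f (?T y)) = (\<lambda>y. f (midpoint x y))"
    by (simp add: midpoint_def scaleR_add_right)
  finally show ?thesis
    by (simp only: mult.assoc[symmetric] cancel mult_1)
qed

lemma interaction_commute:
  fixes A B :: "(real ^ 'n) set"
  assumes [measurable]: "A \<in> sets borel" "B \<in> sets borel" "k \<in> borel_measurable borel"
  shows "interaction k A B = interaction k B A"
proof -
  have "interaction k A B =
      (\<integral>\<^sup>+x. \<integral>\<^sup>+y. k (dist x y) * indicator A x * indicator B y \<partial>lborel \<partial>lborel)"
    unfolding interaction_def by (auto intro!: nn_integral_cong split: split_indicator)
  also have "\<dots> = (\<integral>\<^sup>+y. \<integral>\<^sup>+x. k (dist x y) * indicator A x * indicator B y \<partial>lborel \<partial>lborel)"
    by (rule lborel_pair.Fubini') measurable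
  also have "\<dots> = interaction k B A"
    unfolding interaction_def
    by (auto intro!: nn_integral_cong simp: dist_commute split: split_indicator)
  finally show ?thesis .
qed

text \<open>
  By convexity the midpoint \<open>z\<close> of a pair in \<open>A \<times> B\<close> lies in \<open>A\<close> or in \<open>B\<close>, so \<open>(x, z)\<close> or \<open>(z, y)\<close> is
  again a pair in \<open>A \<times> B\<close>, at half the distance. Each alternative costs a factor \<open>2 ^ n\<close> for
  the change of variables.
\<close>

lemma interaction_halve_distance:
  fixes A B :: "(real ^ 'n) set"
  assumes [measurable]: "A \<in> sets borel" "B \<in> sets borel" "k \<in> borel_measurable borel"
    and "convex (A \<union> B)"
  shows "interaction k A B \<le> 2 ^ (CARD('n) + 1) * interaction (\<lambda>t. k (2 * t)) A B"
proof -
  have one_sided: "(\<integral>\<^sup>+x\<in>C. (\<integral>\<^sup>+y. k (dist x y) * indicator D (midpoint x y) \<partial>lborel) \<partial>lborel)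
      = 2 ^ CARD('n) * interaction (\<lambda>t. k (2 * t)) C D"
    if [measurable]: "C \<in> sets borel" "D \<in> sets borel" for C D :: "(real ^ 'n) set"
  proof -
    have "(\<integral>\<^sup>+y. k (dist x y) * indicator D (midpoint x y) \<partial>lborel)
        = 2 ^ CARD('n) * (\<integral>\<^sup>+z\<in>D. k (2 * dist x z) \<partial>lborel)" for x
      using nn_integral_midpoint[of "\<lambda>z. k (2 * dist x z) * indicator D z" x]
      by (simp add: dist_midpoint)
    then show ?thesis
      unfolding interaction_def
      by (simp add: nn_integral_cmult mult.assoc)
  qed
  have "interaction k A B
      \<le> (\<integral>\<^sup>+x. \<integral>\<^sup>+y. k (dist x y) * indicator A x * indicator B (midpoint x y)
           + k (dist x y) * indicator B y * indicator A (midpoint x y) \<partial>lborel \<partial>lborel)"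
  proof -
    have "k (dist x y) * indicator B y * indicator A x
        \<le> k (dist x y) * indicator A x * indicator B (midpoint x y)
           + k (dist x y) * indicator B y * indicator A (midpoint x y)" for x y
      using convexD[OF assms(4), of x y "1/2" "1/2"]
      by (auto simp: midpoint_def scaleR_add_right split: split_indicator)
    moreover have "interaction k A B
        = (\<integral>\<^sup>+x. \<integral>\<^sup>+y. k (dist x y) * indicator B y * indicator A x \<partial>lborel \<partial>lborel)"
      unfolding interaction_def by (subst nn_integral_multc) simp_all
    ultimately show ?thesis
      by (simp add: nn_integral_mono)
  qed
  also have "\<dots> = (\<integral>\<^sup>+x. \<integral>\<^sup>+y. k (dist x y) * indicator A x * indicator B (midpoint x y) \<partial>lborel \<partial>lborel)
      + (\<integral>\<^sup>+x. \<integral>\<^sup>+y. k (dist x y) * indicator B y * indicator A (midpoint x y) \<partial>lborel \<partial>lborel)"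
    unfolding midpoint_def by (simp add: nn_integral_add)
  also have "(\<integral>\<^sup>+x. \<integral>\<^sup>+y. k (dist x y) * indicator A x * indicator B (midpoint x y) \<partial>lborel \<partial>lborel)
      = 2 ^ CARD('n) * interaction (\<lambda>t. k (2 * t)) A B"
    unfolding one_sided[OF assms(1,2), symmetric]
    by (auto intro!: nn_integral_cong split: split_indicator)
  also have "(\<integral>\<^sup>+x. \<integral>\<^sup>+y. k (dist x y) * indicator B y * indicator A (midpoint x y) \<partial>lborel \<partial>lborel)
      = (\<integral>\<^sup>+y. \<integral>\<^sup>+x. k (dist x y) * indicator B y * indicator A (midpoint x y) \<partial>lborel \<partial>lborel)"
    unfolding midpoint_def by (rule lborel_pair.Fubini') measurable
  also have "\<dots> = 2 ^ CARD('n) * interaction (\<lambda>t. k (2 * t)) B A"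
    unfolding one_sided[OF assms(2,1), symmetric]
    by (auto intro!: nn_integral_cong simp: dist_commute midpoint_sym split: split_indicator)
  also have "interaction (\<lambda>t. k (2 * t)) B A = interaction (\<lambda>t. k (2 * t)) A B"
    by (rule interaction_commute) measurable
  finally show ?thesis
    unfolding mult_2[symmetric] by (simp add: mult.assoc)
qed

section \<open>Far pairs and the factor \<epsilon>\<close>

lemma interaction_cmult_mono:
  fixes A B :: "(real ^ 'n) set"
  assumes [measurable]: "A \<in> sets borel" "B \<in> sets borel" "k' \<in> borel_measurable borel"
    and le: "\<And>t. t \<ge> 0 \<Longrightarrow> k t \<le> c * k' t"
  shows "interaction k A B \<le> c * interaction k' A B"
proof -
  have "interaction k A B \<le> (\<integral>\<^sup>+x\<in>A. (\<integral>\<^sup>+y\<in>B. c * k' (dist x y) \<partial>lborel) \<partial>lborel)"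
    unfolding interaction_def by (intro nn_integral_mono mult_right_mono le) auto
  also have "\<dots> = c * interaction k' A B"
    unfolding interaction_def by (simp add: nn_integral_cmult mult.assoc)
  finally show ?thesis .
qed

lemma interaction_add:
  fixes A B :: "(real ^ 'n) set"
  assumes [measurable]: "A \<in> sets borel" "B \<in> sets borel"
    "k \<in> borel_measurable borel" "k' \<in> borel_measurable borel"
  shows "interaction (\<lambda>t. k t + k' t) A B = interaction k A B + interaction k' A B"
  unfolding interaction_def by (simp add: nn_integral_add distrib_right)

text \<open>
  Doubling the distance multiplies the kernel by \<open>2 powr - (n + 1 - \<epsilon>)\<close>, which cancels the factor
  \<open>2 ^ (n + 1)\<close> of \<open>interaction_halve_distance\<close> up to \<open>2 powr \<epsilon>\<close>.
\<close>

lemma truncated_interaction_halving: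
  fixes A B :: "(real ^ 'n) set" and \<epsilon> :: real
  assumes [measurable]: "A \<in> sets borel" "B \<in> sets borel" and "convex (A \<union> B)"
  defines "J \<equiv> \<lambda>r. interaction
    (\<lambda>t. ennreal (t powr - (real CARD('n) + 1 - \<epsilon>)) * indicator {..r} t) A B"
  shows "J r \<le> ennreal (2 powr (\<epsilon> * real m)) * J (r / 2 ^ m)"
proof (induction m)
  case (Suc m)
  define a where "a = - (real CARD('n) + 1 - \<epsilon>)"
  have step: "J r \<le> ennreal (2 powr \<epsilon>) * J (r / 2)" for r
  proof -
    define k where "k = (\<lambda>r t. ennreal (t powr a) * indicator {..r} t)"
    have [measurable]: "k r \<in> borel_measurable borel" for r
      unfolding k_def by measurable
    have "J r \<le> 2 ^ (CARD('n) + 1) * interaction (\<lambda>t. k r (2 * t)) A B"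
      unfolding J_def k_def a_def by (intro interaction_halve_distance assms) measurable
    also have "interaction (\<lambda>t. k r (2 * t)) A B \<le> ennreal (2 powr a) * interaction (k (r / 2)) A B"
      by (rule interaction_cmult_mono)
        (auto simp: k_def powr_mult ennreal_mult split: split_indicator)
    also have "2 ^ (CARD('n) + 1) * (ennreal (2 powr a) * interaction (k (r / 2)) A B)
        = ennreal (2 powr \<epsilon>) * interaction (k (r / 2)) A B"
    proof -
      have "(2::real) ^ (CARD('n) + 1) * 2 powr a = 2 powr \<epsilon>"
        by (simp add: a_def powr_add[symmetric] powr_realpow[symmetric] del: power_Suc)
      then have "2 ^ (CARD('n) + 1) * ennreal (2 powr a) = ennreal (2 powr \<epsilon>)"
        by (metis ennreal_mult ennreal_numeral ennreal_power powr_ge_zero zero_le_numeral zero_le_power)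
      then show ?thesis by (simp add: mult.assoc[symmetric])
    qed
    finally show ?thesis
      by (simp add: J_def k_def a_def mult_left_mono)
  qed
  have "J r \<le> ennreal (2 powr (\<epsilon> * real m)) * J (r / 2 ^ m)" by (rule Suc)
  also have "\<dots> \<le> ennreal (2 powr (\<epsilon> * real m)) * (ennreal (2 powr \<epsilon>) * J (r / 2 ^ m / 2))"
    by (intro mult_left_mono step) simp
  also have "\<dots> = ennreal (2 powr (\<epsilon> * real (Suc m))) * J (r / 2 ^ Suc m)"
    by (simp add: mult.assoc[symmetric] ennreal_mult[symmetric] powr_add[symmetric] algebra_simps)
  finally show ?case .
qed simp

text \<open>
  Let \<open>I\<close> be the whole energy, \<open>J\<close> its part at distance at most \<open>r = D / 2 ^ m\<close>, and \<open>F\<close> the rest.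
  From \<open>I = J + F\<close> and \<open>I \<le> 2 powr (\<epsilon> * m) * J\<close> it follows that
  \<open>F \<le> (1 - 2 powr (- \<epsilon> * m)) * I \<le> \<epsilon> * m * I\<close>, provided that \<open>I\<close> is finite. On the other hand,
  \<open>F\<close> is at least the smallest value \<open>D powr - (n + 1 - \<epsilon>)\<close> of the kernel times the measure of the
  pairs at distance more than \<open>r\<close>; this measure is bounded below through \<open>h\<close>.
\<close>

lemma fractional_isoperimetric_convex:
  fixes A B :: "(real ^ 'n) set"
  assumes [measurable]: "A \<in> sets borel" "B \<in> sets borel" and conv: "convex (A \<union> B)"
    and "D > 0" and diam: "\<And>x y. x \<in> A \<Longrightarrow> y \<in> B \<Longrightarrow> dist x y \<le> D"
    and "0 < \<epsilon>" "\<epsilon> \<le> 1"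
    and far: "\<And>x. x \<in> A \<Longrightarrow> h \<le> emeasure lborel (B - cball x (D / 2 ^ m))"
  shows "emeasure lborel A * (ennreal (D powr - (real CARD('n) + 1 - \<epsilon>)) * h)
    \<le> ennreal (\<epsilon> * real m) * interaction (\<lambda>t. ennreal (t powr - (real CARD('n) + 1 - \<epsilon>))) A B"
proof -
  define a where "a = - (real CARD('n) + 1 - \<epsilon>)"
  have "a \<le> 0" using \<open>\<epsilon> \<le> 1\<close> by (simp add: a_def)
  define r where "r = D / 2 ^ m"
  define I where "I = interaction (\<lambda>t. ennreal (t powr a)) A B"
  define J where "J = (\<lambda>r. interaction (\<lambda>t. ennreal (t powr a) * indicator {..r} t) A B)"
  define F where "F = interaction (\<lambda>t. ennreal (t powr a) * indicator {r<..} t) A B"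
  have "I = J r + F"
    unfolding I_def J_def F_def
    by (subst interaction_add[symmetric]) (auto intro!: arg_cong[where f="\<lambda>k. interaction k A B"]
        split: split_indicator)
  moreover have "I \<le> ennreal (2 powr (\<epsilon> * real m)) * J r"
  proof -
    have "I = J D"
      unfolding I_def J_def interaction_def
      by (auto intro!: nn_integral_cong simp: diam split: split_indicator)
    also have "\<dots> \<le> ennreal (2 powr (\<epsilon> * real m)) * J r"
      unfolding J_def a_def r_def by (rule truncated_interaction_halving) (use conv in auto)
    finally show ?thesis .
  qed
  ultimately have "F \<le> ennreal (\<epsilon> * real m) * I"
  proof (cases "I = \<infinity>")
    case True
    \<comment> \<open>for \<open>m = 0\<close> the right-hand side is \<open>0 * \<infinity> = 0\<close>, but no pairs are further apart than \<open>D\<close>\<close>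
    show ?thesis
    proof (cases "m = 0")
      case True
      have "F = 0"
        unfolding F_def interaction_def
        using True by (auto simp: nn_integral_0_iff_AE r_def diam not_less split: split_indicator)
      then show ?thesis by simp
    next
      case False
      then show ?thesis
        using \<open>I = \<infinity>\<close> \<open>0 < \<epsilon>\<close> by (simp add: ennreal_mult_top)
    qed
  next
    case False
    assume *: "I = J r + F" "I \<le> ennreal (2 powr (\<epsilon> * real m)) * J r"
    with False have "J r \<noteq> \<infinity>" "F \<noteq> \<infinity>" by auto
    with False obtain i j f where ij: "I = ennreal i" "J r = ennreal j" "F = ennreal f"
      "i \<ge> 0" "j \<ge> 0" "f \<ge> 0"
      by (metis ennreal_cases infinity_ennreal_def)
    have "i = j + f" using *(1) ij by (simp add: ennreal_plus[symmetric] del: ennreal_plus)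
    have "i \<le> 2 powr (\<epsilon> * real m) * j"
      using *(2) ij by (simp add: ennreal_mult[symmetric])
    then have "2 powr - (\<epsilon> * real m) * i \<le> j"
      by (simp add: powr_minus field_simps)
    moreover have "1 - \<epsilon> * real m \<le> 2 powr - (\<epsilon> * real m)"
    proof -
      have "1 - \<epsilon> * real m \<le> 1 - \<epsilon> * real m * ln 2"
        using \<open>0 < \<epsilon>\<close> ln_2_less_1 by (simp add: mult_left_le)
      also have "\<dots> \<le> exp (- (\<epsilon> * real m * ln 2))"
        using exp_ge_add_one_self[of "- (\<epsilon> * real m * ln 2)"] by simp
      finally show ?thesis by (simp add: powr_def)
    qed
    ultimately have "(1 - \<epsilon> * real m) * i \<le> j"
      using \<open>i \<ge> 0\<close> by (meson mult_right_mono order_trans)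
    then have "f \<le> \<epsilon> * real m * i"
      using \<open>i = j + f\<close> by (simp add: algebra_simps)
    then show ?thesis
      using ij \<open>0 < \<epsilon>\<close> by (simp add: ennreal_mult[symmetric])
  qed
  moreover have "emeasure lborel A * (ennreal (D powr a) * h) \<le> F"
  proof -
    have "ennreal (D powr a) * h
        \<le> (\<integral>\<^sup>+y\<in>B. ennreal (dist x y powr a) * indicator {r<..} (dist x y) \<partial>lborel)" if "x \<in> A" for x
    proof -
      have "ennreal (D powr a) * h \<le> ennreal (D powr a) * emeasure lborel (B - cball x r)"
        using far[OF that] by (intro mult_left_mono) (auto simp: r_def)
      also have "\<dots> = (\<integral>\<^sup>+y. ennreal (D powr a) * indicator (B - cball x r) y \<partial>lborel)"
        by (simp add: nn_integral_cmult_indicator)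
      also have "\<dots> \<le> (\<integral>\<^sup>+y\<in>B. ennreal (dist x y powr a) * indicator {r<..} (dist x y) \<partial>lborel)"
      proof (rule nn_integral_mono)
        fix y
        have "r > 0" using \<open>D > 0\<close> by (simp add: r_def)
        then show "ennreal (D powr a) * indicator (B - cball x r) y
            \<le> ennreal (dist x y powr a) * indicator {r<..} (dist x y) * indicator B y"
          using diam[OF that, of y] \<open>a \<le> 0\<close>
          by (auto intro!: ennreal_leI powr_mono2' split: split_indicator)
      qed
      finally show ?thesis .
    qed
    then have "(\<integral>\<^sup>+x\<in>A. ennreal (D powr a) * h \<partial>lborel) \<le> F"
      unfolding F_def interaction_def
      by (intro nn_integral_mono) (auto split: split_indicator)
    then show ?thesis
      using nn_integral_cmult_indicator[of A lborel "ennreal (D powr a) * h"]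
      by (simp add: mult.commute)
  qed
  ultimately show ?thesis
    unfolding I_def a_def by (rule order_trans[rotated])
qed

section \<open>Cubes\<close>

definition half_open_cube :: "real ^ 'n \<Rightarrow> real \<Rightarrow> (real ^ 'n) set" where
  "half_open_cube a L = {x. \<forall>i. a $ i \<le> x $ i \<and> x $ i < a $ i + L}"

lemma half_open_cube_borel [measurable, simp]: "half_open_cube a L \<in> sets borel"
  unfolding half_open_cube_def by measurable

lemma convex_half_open_cube: "convex (half_open_cube a L :: (real ^ 'n) set)"
proof -
  have "half_open_cube a L = (\<Inter>i. {x. a $ i \<le> x $ i} \<inter> {x. x $ i < a $ i + L})"
    by (auto simp: half_open_cube_def)
  moreover have "convex {x :: real^'n. a $ i \<le> x $ i}" "convex {x :: real^'n. x $ i < a $ i + L}" for i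
    using convex_halfspace_ge[of "a $ i" "axis i 1 :: real ^ 'n"]
      convex_halfspace_lt[of "axis i 1 :: real ^ 'n" "a $ i + L"]
    by (simp_all add: inner_axis' inner_axis inner_real_def)
  ultimately show ?thesis
    by (auto intro!: convex_INT convex_Int)
qed

lemma emeasure_cbox_cube:
  assumes "L \<ge> 0"
  shows "emeasure lborel (cbox a (a + (\<chi> i. L)) :: (real ^ 'n) set) = ennreal (L ^ CARD('n))"
proof -
  have "cbox a (a + (\<chi> i. L)) \<noteq> {}"
    using assms by (auto simp: interval_ne_empty_cart)
  then have "measure lborel (cbox a (a + (\<chi> i. L)) :: (real ^ 'n) set) = L ^ CARD('n)"
    by (simp add: content_cbox_cart)
  then show ?thesis
    by (metis emeasure_eq_ennreal_measure emeasure_lborel_cbox_finite infinity_ennreal_def less_irrefl)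
qed

text \<open>
  The set \<open>S\<close> may contain any part of the faces, Borel or not; hence the Lebesgue measure on
  the left.
\<close>

lemma emeasure_between_box_cbox:
  assumes "box a b \<subseteq> S" "S \<subseteq> cbox a b"
  shows "emeasure lebesgue S = emeasure lborel (cbox a b)"
proof -
  have "negligible (S - box a b)"
    by (rule negligible_subset[OF negligible_frontier_interval]) (use assms in blast)
  then have "emeasure lebesgue (box a b \<union> (S - box a b)) = emeasure lebesgue (box a b)"
    by (intro emeasure_Un_null_set) (auto simp: negligible_iff_null_sets)
  moreover have "box a b \<union> (S - box a b) = S" using assms by blast
  ultimately show ?thesis
    by (simp add: emeasure_lborel_box_eq emeasure_lborel_cbox_eq)
qed

lemma emeasure_half_open_cube:
  assumes "L > 0"
  shows "emeasure lborel (half_open_cube a L :: (real ^ 'n) set) = ennreal (L ^ CARD('n))"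
proof -
  have "box a (a + (\<chi> i. L)) \<subseteq> half_open_cube a L" "half_open_cube a L \<subseteq> cbox a (a + (\<chi> i. L))"
    by (auto simp: half_open_cube_def mem_box_cart less_imp_le)
  from emeasure_between_box_cbox[OF this] show ?thesis
    using assms by (simp add: emeasure_cbox_cube)
qed

lemma is_cube_half_open_cube: "L > 0 \<Longrightarrow> is_cube (half_open_cube a L)"
  unfolding is_cube_def half_open_cube_def
  by (intro exI[of _ "\<lambda>i. {a $ i..<a $ i + L}"] exI[of _ L]) (auto simp: is_interval_co)

lemma dist_half_open_cube_le:
  fixes x y :: "real ^ 'n"
  assumes "x \<in> half_open_cube a L" "y \<in> half_open_cube a L"
  shows "dist x y \<le> real CARD('n) * L"
proof -
  have "dist x y \<le> (\<Sum>i\<in>UNIV. \<bar>(x - y) $ i\<bar>)"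
    by (simp only: dist_norm norm_le_l1_cart)
  also have "\<dots> \<le> (\<Sum>i\<in>(UNIV :: 'n set). L)"
  proof (rule sum_mono)
    fix i
    have "a $ i \<le> x $ i" "x $ i < a $ i + L" "a $ i \<le> y $ i" "y $ i < a $ i + L"
      using assms by (auto simp: half_open_cube_def)
    then show "\<bar>(x - y) $ i\<bar> \<le> L" by simp
  qed
  finally show ?thesis by simp
qed

lemma emeasure_cball_le:
  assumes "r \<ge> 0"
  shows "emeasure lborel (cball x r :: (real ^ 'n) set) \<le> ennreal ((2 * r) ^ CARD('n))"
proof -
  have "cball x r \<subseteq> cbox (x - (\<chi> i. r)) ((x - (\<chi> i. r)) + (\<chi> i. 2 * r))"
  proof
    fix y assume "y \<in> cball x r"
    then have "norm (y - x) \<le> r" by (simp add: dist_norm norm_minus_commute)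
    then have "\<bar>(y - x) $ i\<bar> \<le> r" for i
      by (rule order_trans[OF component_le_norm_cart])
    then show "y \<in> cbox (x - (\<chi> i. r)) ((x - (\<chi> i. r)) + (\<chi> i. 2 * r))"
      by (auto simp: mem_box_cart abs_le_iff algebra_simps) 
  qed
  then have "emeasure lborel (cball x r) \<le> emeasure lborel (cbox (x - (\<chi> i. r)) ((x - (\<chi> i. r)) + (\<chi> i. 2 * r)))"
    by (rule emeasure_mono) simp
  then show ?thesis
    using assms by (simp add: emeasure_cbox_cube)
qed

lemma bounded_half_open_cube: "bounded (half_open_cube a L)"
  by (rule bounded_subset[OF bounded_cbox[of a "a + (\<chi> i. L)"]])
    (auto simp: half_open_cube_def mem_box_cart less_imp_le)

text \<open>
  Every cube agrees with a half-open one up to its faces, a null set. This allows all further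
  work to be done in half-open cubes, which can be partitioned exactly.
\<close>

lemma is_cube_sandwich:
  assumes "is_cube (Q :: (real ^ 'n) set)"
  obtains a L where "L > 0" "box a (a + (\<chi> i. L)) \<subseteq> Q" "Q \<subseteq> cbox a (a + (\<chi> i. L))"
proof -
  obtain I L where L: "L > 0" and I: "\<And>i. is_interval (I i)" "\<And>i. emeasure lborel (I i) = ennreal L"
    and Q: "Q = {x. \<forall>i. x $ i \<in> I i}"
    using assms unfolding is_cube_def by (elim exE conjE) (rule that, auto)
  have "\<exists>\<alpha>. {\<alpha><..<\<alpha> + L} \<subseteq> I i \<and> I i \<subseteq> {\<alpha>..\<alpha> + L}" for i
  proof -
    have sub: "{x..y} \<subseteq> I i" if "x \<in> I i" "y \<in> I i" for x y
      using mem_is_interval_1_I[OF I(1) that] by auto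
    have meas: "I i \<in> sets lborel"
    proof (rule ccontr)
      assume "I i \<notin> sets lborel"
      then have "ennreal L = 0" using emeasure_notin_sets I(2)[of i] by metis
      then show False using L by simp
    qed
    have diam: "y - x \<le> L" if "x \<in> I i" "y \<in> I i" for x y
    proof (cases "x \<le> y")
      case True
      have "emeasure lborel {x..y} \<le> emeasure lborel (I i)"
        by (rule emeasure_mono[OF sub[OF that] meas])
      then show ?thesis using True L I(2)[of i] by simp
    qed (use L in simp)
    have "I i \<noteq> {}" using I(2)[of i] L by auto
    then obtain z where z: "z \<in> I i" by blast
    have bdd: "bdd_below (I i)" "bdd_above (I i)"
    proof -
      show "bdd_below (I i)"
        by (rule bdd_belowI[of _ "z - L"]) (use diam[OF _ z] in force)
      show "bdd_above (I i)"
        by (rule bdd_aboveI[of _ "z + L"]) (use diam[OF z] in force)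
    qed
    define \<alpha> \<beta> where "\<alpha> = Inf (I i)" and "\<beta> = Sup (I i)"
    have outer: "I i \<subseteq> {\<alpha>..\<beta>}"
      using bdd by (auto simp: \<alpha>_def \<beta>_def cInf_lower cSup_upper)
    have inner: "{\<alpha><..<\<beta>} \<subseteq> I i"
    proof
      fix t assume "t \<in> {\<alpha><..<\<beta>}"
      then obtain x y where "x \<in> I i" "x < t" "y \<in> I i" "t < y"
        using cInf_lessD[OF \<open>I i \<noteq> {}\<close>, of t] less_cSupE[of t "I i"] \<open>I i \<noteq> {}\<close>
        unfolding \<alpha>_def \<beta>_def greaterThanLessThan_iff by metis
      then show "t \<in> I i" using sub[of x y] by auto
    qed
    have "\<alpha> \<le> \<beta>" using outer z by auto
    then have "ennreal (\<beta> - \<alpha>) \<le> ennreal L" "ennreal L \<le> ennreal (\<beta> - \<alpha>)"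
      using emeasure_mono[OF inner meas] emeasure_mono[OF outer, of lborel] I(2)[of i] by auto
    then have "\<beta> = \<alpha> + L" using L \<open>\<alpha> \<le> \<beta>\<close> by (auto simp: ennreal_le_iff2)
    then show ?thesis using inner outer by blast
  qed
  then obtain \<alpha> where \<alpha>: "\<And>i. {\<alpha> i<..<\<alpha> i + L} \<subseteq> I i" "\<And>i. I i \<subseteq> {\<alpha> i..\<alpha> i + L}"
    by metis
  show thesis
  proof
    show "L > 0" by fact
    show "box (\<chi> i. \<alpha> i) ((\<chi> i. \<alpha> i) + (\<chi> i. L)) \<subseteq> Q"
      using \<alpha>(1) by (auto simp: Q mem_box_cart subset_iff)
    show "Q \<subseteq> cbox (\<chi> i. \<alpha> i) ((\<chi> i. \<alpha> i) + (\<chi> i. L))"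
      using \<alpha>(2) by (auto simp: Q mem_box_cart subset_iff)
  qed
qed

lemma sets_lebesgue_is_cube:
  assumes "is_cube (Q :: (real ^ 'n) set)"
  shows "Q \<in> sets lebesgue"
proof -
  obtain a L where "box a (a + (\<chi> i. L)) \<subseteq> Q" "Q \<subseteq> cbox a (a + (\<chi> i. L))"
    by (rule is_cube_sandwich[OF assms])
  then have "negligible (Q - box a (a + (\<chi> i. L)))" "Q = box a (a + (\<chi> i. L)) \<union> (Q - box a (a + (\<chi> i. L)))"
    by (auto intro: negligible_subset[OF negligible_frontier_interval[of a "a + (\<chi> i. L)"]])
  then show ?thesis
    by (metis negligible_imp_sets sets.Un borel_open open_box sets_completionI_sets sets_lborel)
qed

section \<open>The fractional isoperimetric inequality in a cube\<close>

text \<open>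
  Here \<open>8 * n\<close> is the number of halvings after which the scale is far below the side length of
  the cube, \<open>n ^ (n + 1)\<close> is the cost of replacing the diameter bound \<open>n * L\<close> by \<open>L\<close> in the kernel,
  and \<open>2 ^ (n + 3) = 2 ^ (n + 1) * 4\<close> accounts for the fraction \<open>1 / 2 ^ (n + 1)\<close> of the cube filled
  by one set and the fraction \<open>1/4\<close> filled by the points of the other set that are far away.
\<close>

definition isoperimetric_constant :: "nat \<Rightarrow> real" where
  "isoperimetric_constant n = real (8 * n) * real n ^ (n + 1) * 2 ^ (n + 3)"

text \<open>
  With \<open>D = n * L\<close> and \<open>m = 8 * n\<close>, a ball of radius \<open>r = D / 2 ^ m \<le> L / 8\<close> fills at most a quarter of
  the cube. As \<open>B\<close> fills at least half of it, every point of \<open>A\<close> has distance more than \<open>r\<close> from a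
  set of points of \<open>B\<close> that fills a quarter.
\<close>

lemma fractional_isoperimetric_cube:
  fixes A B :: "(real ^ 'n) set"
  assumes [measurable]: "A \<in> sets borel" "B \<in> sets borel"
    and P: "A \<union> B = half_open_cube a L" and "A \<inter> B = {}" and "L > 0" and "0 < \<epsilon>" "\<epsilon> \<le> 1"
    and upper: "emeasure lborel A \<le> ennreal (L ^ CARD('n) / 2)"
    and lower: "ennreal (L ^ CARD('n) / 2 ^ (CARD('n) + 1)) \<le> emeasure lborel A"
  shows "ennreal (L powr (real CARD('n) - 1 + \<epsilon>))
    \<le> ennreal (isoperimetric_constant CARD('n) * \<epsilon>)
       * interaction (\<lambda>t. ennreal (t powr - (real CARD('n) + 1 - \<epsilon>))) A B"
proof -
  let ?n = "CARD('n)"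
  define a' where "a' = real ?n + 1 - \<epsilon>"
  define D where "D = real ?n * L"
  define r where "r = D / 2 ^ (8 * ?n)"
  define I where "I = interaction (\<lambda>t. ennreal (t powr - a')) A B"
  have "D > 0" "r > 0" using \<open>L > 0\<close> by (auto simp: D_def r_def)
  have r: "2 * r \<le> L / 4"
  proof -
    have "8 * real ?n \<le> 2 ^ (8 * ?n)"
      using of_nat_mono[OF less_imp_le[OF less_exp[of "8 * ?n"]], where 'a = real] by simp
    then show ?thesis
      using \<open>L > 0\<close> by (simp add: r_def D_def field_simps)
  qed
  have near: "emeasure lborel (cball x r) \<le> ennreal (L ^ ?n / 4)" for x :: "real^'n"
  proof -
    have "(2 * r) ^ ?n \<le> (L / 4) ^ ?n"
      using r \<open>r > 0\<close> by (intro power_mono) auto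
    also have "\<dots> \<le> L ^ ?n / 4"
      unfolding power_divide using \<open>L > 0\<close> self_le_power[of "4::real" ?n]
      by (intro divide_left_mono) auto
    finally show ?thesis
      using emeasure_cball_le[of r x] \<open>r > 0\<close> by (simp add: order_trans ennreal_leI)
  qed
  have far: "ennreal (L ^ ?n / 4) \<le> emeasure lborel (B - cball x r)" for x :: "real^'n"
  proof -
    have "ennreal (L ^ ?n) = emeasure lborel (A \<union> B)"
      unfolding P using \<open>L > 0\<close> by (simp add: emeasure_half_open_cube)
    also have "\<dots> \<le> emeasure lborel (A \<union> (cball x r \<union> (B - cball x r)))"
      by (rule emeasure_mono) auto
    also have "\<dots> \<le> emeasure lborel A + (emeasure lborel (cball x r) + emeasure lborel (B - cball x r))"
      by (intro order_trans[OF emeasure_subadditive] add_left_mono emeasure_subadditive) auto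
    also have "\<dots> \<le> ennreal (L ^ ?n / 2) + (ennreal (L ^ ?n / 4) + emeasure lborel (B - cball x r))"
      by (intro add_mono upper near order_refl)
    finally have "ennreal (L ^ ?n)
        \<le> ennreal (L ^ ?n / 2) + (ennreal (L ^ ?n / 4) + emeasure lborel (B - cball x r))" .
    then show ?thesis
      using \<open>L > 0\<close>
      by (cases "emeasure lborel (B - cball x r)")
        (auto simp: ennreal_plus[symmetric] simp del: ennreal_plus)
  qed
  have "ennreal (L ^ ?n / 2 ^ (?n + 1) * (D powr - a' * (L ^ ?n / 4)))
      \<le> emeasure lborel A * (ennreal (D powr - a') * ennreal (L ^ ?n / 4))"
  proof -
    have "ennreal (L ^ ?n / 2 ^ (?n + 1) * (D powr - a' * (L ^ ?n / 4)))
        = ennreal (L ^ ?n / 2 ^ (?n + 1)) * (ennreal (D powr - a') * ennreal (L ^ ?n / 4))"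
      using \<open>L > 0\<close> by (simp only: ennreal_mult[symmetric] powr_ge_zero mult_nonneg_nonneg
          divide_nonneg_nonneg zero_le_power less_imp_le zero_le_numeral)
    then show ?thesis
      using lower by (simp only: mult_right_mono zero_le)
  qed
  also have "\<dots> \<le> ennreal (\<epsilon> * real (8 * ?n)) * I"
    unfolding I_def a'_def
  proof (rule fractional_isoperimetric_convex)
    show "dist x y \<le> D" if "x \<in> A" "y \<in> B" for x y
      using that P unfolding D_def by (intro dist_half_open_cube_le[of _ a]) auto
  qed (use far assms \<open>D > 0\<close> convex_half_open_cube[of a L] in \<open>auto simp: r_def\<close>)
  finally have main: "ennreal (L ^ ?n / 2 ^ (?n + 1) * (D powr - a' * (L ^ ?n / 4)))
      \<le> ennreal (\<epsilon> * real (8 * ?n)) * I" .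
  have "L powr (real ?n - 1 + \<epsilon>)
      \<le> (real ?n ^ (?n + 1) * 2 ^ (?n + 3)) * (L ^ ?n / 2 ^ (?n + 1) * (D powr - a' * (L ^ ?n / 4)))"
  proof -
    have "L powr (real ?n - 1 + \<epsilon>) = L ^ ?n * L ^ ?n * L powr - a'"
    proof -
      have "real ?n - 1 + \<epsilon> = real ?n + real ?n + - a'" by (simp add: a'_def)
      then show ?thesis
        using \<open>L > 0\<close> by (simp only: powr_add powr_realpow)
    qed
    also have "\<dots> \<le> real ?n ^ (?n + 1) * real ?n powr - a' * (L ^ ?n * L ^ ?n * L powr - a')"
    proof -
      have "real ?n powr a' \<le> real ?n powr real (?n + 1)"
        using \<open>0 < \<epsilon>\<close> by (intro powr_mono) (auto simp: a'_def Suc_le_eq)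
      then have "1 \<le> real ?n ^ (?n + 1) * real ?n powr - a'"
        by (simp add: powr_realpow[symmetric] powr_minus field_simps del: power_Suc)
      then show ?thesis
        using mult_right_mono[of 1 _ "L ^ ?n * L ^ ?n * L powr - a'"] \<open>L > 0\<close> by simp
    qed
    also have "\<dots> = (real ?n ^ (?n + 1) * 2 ^ (?n + 3)) * (L ^ ?n / 2 ^ (?n + 1) * (D powr - a' * (L ^ ?n / 4)))"
    proof -
      have D: "D powr - a' = real ?n powr - a' * L powr - a'"
        using \<open>L > 0\<close> by (simp add: D_def powr_mult)
      have two: "(2::real) ^ (?n + 3) = 8 * 2 ^ ?n" "(2::real) ^ (?n + 1) = 2 * 2 ^ ?n"
        by (simp_all add: power_add)
      have "x * p * (l * l * q) = x * (8 * u) * (l / (2 * u) * (p * q * (l / 4)))"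
        if "u > 0" for x u l p q :: real
        using that by (simp add: field_simps)
      then show ?thesis
        unfolding D two by simp
    qed
    finally show ?thesis .
  qed
  then have "ennreal (L powr (real ?n - 1 + \<epsilon>))
      \<le> ennreal (real ?n ^ (?n + 1) * 2 ^ (?n + 3))
        * ennreal (L ^ ?n / 2 ^ (?n + 1) * (D powr - a' * (L ^ ?n / 4)))"
    using \<open>L > 0\<close> by (subst ennreal_mult[symmetric]) (auto intro!: ennreal_leI simp del: power_Suc)
  also have "\<dots> \<le> ennreal (real ?n ^ (?n + 1) * 2 ^ (?n + 3)) * (ennreal (\<epsilon> * real (8 * ?n)) * I)"
    by (intro mult_left_mono main) simp
  also have "\<dots> = ennreal (isoperimetric_constant ?n * \<epsilon>) * I"
    unfolding mult.assoc[symmetric] using \<open>0 < \<epsilon>\<close>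
    by (subst ennreal_mult[symmetric]) (auto simp: isoperimetric_constant_def mult_ac)
  finally show ?thesis
    unfolding I_def a'_def .
qed

section \<open>Dyadic cubes and the stopping time\<close>

text \<open>
  The cell of generation \<open>k\<close> that contains \<open>x\<close>, in the grid with origin \<open>a\<close> and side lengths
  \<open>L / 2 ^ k\<close>. Indexing cells by their points makes each generation the classes of an equivalence
  relation, so that disjointness and nesting need no arithmetic with cell indices.
\<close>

definition dyadic_cube :: "real ^ 'n \<Rightarrow> real \<Rightarrow> nat \<Rightarrow> real ^ 'n \<Rightarrow> (real ^ 'n) set" where
  "dyadic_cube a L k x =
    {y. \<forall>i. \<lfloor>2 ^ k * ((y $ i - a $ i) / L)\<rfloor> = \<lfloor>2 ^ k * ((x $ i - a $ i) / L)\<rfloor>}"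

lemma dyadic_cube_self: "x \<in> dyadic_cube a L k x"
  by (simp add: dyadic_cube_def)

lemma dyadic_cube_eqI: "y \<in> dyadic_cube a L k x \<Longrightarrow> dyadic_cube a L k y = dyadic_cube a L k x"
  by (auto simp: dyadic_cube_def)

lemma dyadic_cube_antimono:
  assumes "j \<le> k"
  shows "dyadic_cube a L k x \<subseteq> dyadic_cube a L j x"
  using assms
proof (induction rule: dec_induct)
  case (step k)
  have half: "\<lfloor>2 ^ k * t\<rfloor> = \<lfloor>2 ^ Suc k * t\<rfloor> div 2" for t :: real
    using floor_divide_real_eq_div[of 2 "2 ^ Suc k * t"] by simp
  have "dyadic_cube a L (Suc k) x \<subseteq> dyadic_cube a L k x"
    by (simp only: dyadic_cube_def mem_Collect_eq half subset_iff) simp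
  with step.IH show ?case by blast
qed simp

lemma countable_dyadic_cubes: "countable {dyadic_cube a L k x | k x. True}"
proof (rule countable_subset)
  let ?f = "\<lambda>(k::nat, z). {y. \<forall>i. \<lfloor>2 ^ k * ((y $ i - a $ i) / L)\<rfloor> = (z i :: int)}"
  show "{dyadic_cube a L k x | k x. True} \<subseteq> range ?f"
  proof clarify
    fix k x
    have "dyadic_cube a L k x = ?f (k, \<lambda>i. \<lfloor>2 ^ k * ((x $ i - a $ i) / L)\<rfloor>)"
      by (simp add: dyadic_cube_def)
    then show "dyadic_cube a L k x \<in> range ?f" by blast
  qed
qed simp

lemma dyadic_cube_is_half_open_cube:
  assumes "L > 0"
  shows "dyadic_cube a L k x =
    half_open_cube (\<chi> i. a $ i + L / 2 ^ k * of_int \<lfloor>2 ^ k * ((x $ i - a $ i) / L)\<rfloor>) (L / 2 ^ k)"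
proof -
  have cell: "\<lfloor>2 ^ k * (t / L)\<rfloor> = z
      \<longleftrightarrow> L / 2 ^ k * of_int z \<le> t \<and> t < L / 2 ^ k * of_int z + L / 2 ^ k" for t z
    using assms by (simp add: floor_eq_iff field_simps)
  show ?thesis
    by (simp only: dyadic_cube_def half_open_cube_def cell vec_lambda_beta) (auto simp: algebra_simps)
qed

lemma dyadic_cube_0:
  assumes "L > 0" "x \<in> half_open_cube a L"
  shows "dyadic_cube a L 0 x = half_open_cube a L"
proof -
  have "\<lfloor>(x $ i - a $ i) / L\<rfloor> = 0" for i
    using assms by (auto simp: half_open_cube_def floor_eq_iff field_simps)
  then show ?thesis
    using assms(1) by (simp add: dyadic_cube_is_half_open_cube)
qed

lemma dyadic_cube_borel [measurable, simp]: "L > 0 \<Longrightarrow> dyadic_cube a L k x \<in> sets borel"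
  by (simp add: dyadic_cube_is_half_open_cube)

lemma emeasure_dyadic_cube:
  "L > 0 \<Longrightarrow> emeasure lborel (dyadic_cube a L k x :: (real ^ 'n) set) = ennreal ((L / 2 ^ k) ^ CARD('n))"
  by (simp add: dyadic_cube_is_half_open_cube emeasure_half_open_cube)

lemma open_contains_dyadic_cube:
  fixes x :: "real ^ 'n"
  assumes "open U" "x \<in> U" "L > 0"
  obtains k where "dyadic_cube a L k x \<subseteq> U"
proof -
  obtain d where "d > 0" "ball x d \<subseteq> U"
    using assms open_contains_ball by blast
  obtain k where k: "(1/2) ^ k < d / (real CARD('n) * L)"
    using real_arch_pow_inv[of "d / (real CARD('n) * L)" "1/2"] \<open>d > 0\<close> \<open>L > 0\<close> by auto
  have "dist x y < d" if "y \<in> dyadic_cube a L k x" for y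
  proof -
    have "dist x y \<le> real CARD('n) * (L / 2 ^ k)"
      using that dyadic_cube_self[of x a L k] \<open>L > 0\<close>
      unfolding dyadic_cube_is_half_open_cube[OF \<open>L > 0\<close>] by (intro dist_half_open_cube_le)
    also have "\<dots> < d"
      using k \<open>L > 0\<close> by (simp add: power_one_over field_simps)
    finally show ?thesis .
  qed
  then show thesis
    using that \<open>ball x d \<subseteq> U\<close> by (auto simp: subset_iff)
qed

text \<open>
  In a decreasing sequence of partitions, the cells in \<open>G\<close> that have no coarser cell in \<open>G\<close>
  around them are pairwise disjoint and have the same union as all cells in \<open>G\<close>. They are
  enumerated by natural numbers, with empty sets at the unused indices.
\<close>

lemma nested_partitions_disjoint_cover:
  fixes C :: "nat \<Rightarrow> 'a \<Rightarrow> 'a set"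
  assumes self: "\<And>k x. x \<in> C k x"
    and eq: "\<And>k x y. y \<in> C k x \<Longrightarrow> C k y = C k x"
    and mono: "\<And>j k x. j \<le> k \<Longrightarrow> C k x \<subseteq> C j x"
    and count: "countable {C k x | k x. True}"
  shows "\<exists>P :: nat \<Rightarrow> 'a set. disjoint_family P
    \<and> (\<forall>i. P i = {} \<or> (\<exists>k x. P i = C k x \<and> C k x \<in> G))
    \<and> (\<Union>i. P i) = \<Union>{C k x | k x. C k x \<in> G}"
proof -
  define F where "F = {C k x | k x. C k x \<in> G \<and> (\<forall>j<k. C j x \<notin> G)}"
  have F: "countable F"
    by (rule countable_subset[OF _ count]) (auto simp: F_def)
  have disj: "S \<inter> T = {}" if S: "S \<in> F" and T: "T \<in> F" and "S \<noteq> T" for S T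
  proof (rule ccontr)
    assume "S \<inter> T \<noteq> {}"
    then obtain y where y: "y \<in> S" "y \<in> T" by blast
    have rep: "\<exists>k. R = C k y \<and> C k y \<in> G \<and> (\<forall>j<k. C j y \<notin> G)" if "R \<in> F" "y \<in> R" for R
    proof -
      from that obtain k x where kx: "R = C k x" "C k x \<in> G" "\<forall>j<k. C j x \<notin> G"
        by (auto simp: F_def)
      have "C j y = C j x" if "j \<le> k" for j
        using mono[OF that, of x] \<open>y \<in> R\<close> kx(1) by (intro eq) auto
      then show ?thesis
        using kx by (metis less_imp_le order_refl)
    qed
    obtain k where k: "S = C k y" "C k y \<in> G" "\<forall>j<k. C j y \<notin> G" using rep[OF S] y by blast
    obtain l where l: "T = C l y" "C l y \<in> G" "\<forall>j<l. C j y \<notin> G" using rep[OF T] y by blast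
    have "k = l" using k l by (metis nat_neq_iff)
    then show False using k l \<open>S \<noteq> T\<close> by simp
  qed
  define P where "P i = (if i \<in> to_nat_on F ` F then from_nat_into F i else {})" for i
  have P_to_nat: "P (to_nat_on F S) = S" if "S \<in> F" for S
    unfolding P_def if_P[OF imageI[OF that]] by (rule from_nat_into_to_nat_on[OF F that])
  have P_index: "\<exists>S\<in>F. i = to_nat_on F S" if "P i \<noteq> {}" for i
  proof -
    have "i \<in> to_nat_on F ` F" using that unfolding P_def by presburger
    then show ?thesis by blast
  qed
  then have PF: "P i \<in> F" if "P i \<noteq> {}" for i
    using that P_to_nat by metis
  have "disjoint_family P"
    unfolding disjoint_family_on_def
  proof (intro ballI impI)
    fix i j :: nat assume "i \<noteq> j"
    show "P i \<inter> P j = {}"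
    proof (cases "P i = {} \<or> P j = {}")
      case False
      then obtain S T where ST: "S \<in> F" "T \<in> F" "i = to_nat_on F S" "j = to_nat_on F T"
        using P_index[of i] P_index[of j] by blast
      with \<open>i \<noteq> j\<close> have "S \<noteq> T" by auto
      then show ?thesis using disj ST P_to_nat by metis
    qed auto
  qed
  moreover have "P i = {} \<or> (\<exists>k x. P i = C k x \<and> C k x \<in> G)" for i
    using PF[of i] by (auto simp: F_def)
  moreover have "(\<Union>i. P i) = \<Union>{C k x | k x. C k x \<in> G}"
  proof (intro subset_antisym subsetI)
    fix y assume "y \<in> (\<Union>i. P i)"
    then obtain i where "y \<in> P i" by blast
    moreover from this have "P i \<in> F" using PF[of i] by blast
    ultimately show "y \<in> \<Union>{C k x | k x. C k x \<in> G}"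
      unfolding F_def by blast
  next
    fix y assume "y \<in> \<Union>{C k x | k x. C k x \<in> G}"
    then obtain k x where "y \<in> C k x" "C k x \<in> G" by blast
    then have "C k y \<in> G" by (simp add: eq)
    define m where "m = (LEAST k. C k y \<in> G)"
    have "C m y \<in> F"
    proof -
      have "C m y \<in> G"
        unfolding m_def by (rule LeastI) fact
      moreover have "\<forall>j<m. C j y \<notin> G"
        unfolding m_def using not_less_Least by blast
      ultimately show ?thesis
        unfolding F_def by blast
    qed
    then show "y \<in> (\<Union>i. P i)"
      using P_to_nat[of "C m y"] self[of y m] by blast
  qed
  ultimately show ?thesis by blast
qed

lemma dyadic_disjoint_cover:
  "\<exists>P :: nat \<Rightarrow> (real ^ 'n) set. disjoint_family P
    \<and> (\<forall>i. P i = {} \<or> (\<exists>k x. P i = dyadic_cube a L k x \<and> dyadic_cube a L k x \<in> G))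
    \<and> (\<Union>i. P i) = \<Union>{dyadic_cube a L k x | k x. dyadic_cube a L k x \<in> G}"
  by (rule nested_partitions_disjoint_cover)
    (use dyadic_cube_self dyadic_cube_eqI dyadic_cube_antimono countable_dyadic_cubes in blast)+

text \<open>
  A dyadic form of the Lebesgue density theorem, with density one half. Every dyadic cube that
  meets the exceptional set \<open>N\<close> is at most half filled by \<open>E\<close>, hence by \<open>N\<close>. An open set \<open>U \<supseteq> N\<close> is a disjoint union
  of dyadic cubes, so \<open>N\<close> has at most half the measure of \<open>U\<close>; when \<open>U\<close> is chosen with
  measure less than twice that of \<open>N\<close>, this is impossible unless \<open>N\<close> is null.
\<close>

lemma null_set_outside_majority_cubes:
  fixes E :: "(real ^ 'n) set"
  assumes [measurable]: "E \<in> sets borel" and "emeasure lborel E \<noteq> \<infinity>" and "L > 0"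
  defines "G \<equiv> {C. emeasure lborel C < 2 * emeasure lborel (E \<inter> C)}"
  shows "E - \<Union>{dyadic_cube a L k x | k x. dyadic_cube a L k x \<in> G} \<in> null_sets lborel"
proof -
  define N where "N = E - \<Union>{dyadic_cube a L k x | k x. dyadic_cube a L k x \<in> G}"
  have "\<Union>{dyadic_cube a L k x | k x. dyadic_cube a L k x \<in> G} \<in> sets borel"
    by (rule sets.countable_Union)
      (use \<open>L > 0\<close> in \<open>auto intro: countable_subset[OF _ countable_dyadic_cubes[of a L]]\<close>)
  then have [measurable]: "N \<in> sets borel" by (simp add: N_def)
  have "emeasure lborel N \<le> emeasure lborel E"
    by (rule emeasure_mono) (auto simp: N_def)
  then obtain e where e: "emeasure lborel N = ennreal e" "e \<ge> 0"
    using assms(2) by (cases "emeasure lborel N") (auto simp: top_unique)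
  have "e = 0"
  proof (rule ccontr)
    assume "e \<noteq> 0"
    with e(2) have "e > 0" by simp
    obtain U where U: "open U" "N \<subseteq> U" "emeasure lebesgue (U - N) < ennreal e"
      using sets_lebesgue_outer_open[of N e] \<open>e > 0\<close> by auto
    have [measurable]: "U \<in> sets borel" using U(1) by simp
    obtain P :: "nat \<Rightarrow> (real ^ 'n) set" where P: "disjoint_family P"
      "\<forall>i. P i = {} \<or> (\<exists>k x. P i = dyadic_cube a L k x \<and> dyadic_cube a L k x \<in> Pow U)"
      "(\<Union>i. P i) = \<Union>{dyadic_cube a L k x | k x. dyadic_cube a L k x \<in> Pow U}"
      using dyadic_disjoint_cover[of a L "Pow U"] by blast
    have [measurable]: "P i \<in> sets borel" for i
      using P(2)[rule_format, of i] \<open>L > 0\<close> by auto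
    have UP: "(\<Union>i. P i) = U"
      unfolding P(3)
    proof (intro subset_antisym subsetI)
      fix x assume "x \<in> U"
      then obtain k where "dyadic_cube a L k x \<subseteq> U"
        using open_contains_dyadic_cube U(1) \<open>L > 0\<close> by metis
      then show "x \<in> \<Union>{dyadic_cube a L k x | k x. dyadic_cube a L k x \<in> Pow U}"
        using dyadic_cube_self[of x a L k] by blast
    qed auto
    have half: "2 * emeasure lborel (N \<inter> P i) \<le> emeasure lborel (P i)" for i
    proof (cases "N \<inter> P i = {}")
      case False
      with P(2)[rule_format, of i] obtain k x where Pi: "P i = dyadic_cube a L k x" by auto
      have "P i \<notin> G" using False unfolding Pi N_def by blast
      then have "2 * emeasure lborel (E \<inter> P i) \<le> emeasure lborel (P i)"
        by (simp add: G_def not_less)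
      moreover have "emeasure lborel (N \<inter> P i) \<le> emeasure lborel (E \<inter> P i)"
        by (rule emeasure_mono) (auto simp: N_def)
      ultimately show ?thesis
        by (meson mult_left_mono order_trans zero_le)
    qed simp
    have "2 * emeasure lborel N = 2 * emeasure lborel (\<Union>i. N \<inter> P i)"
      using UP U(2) by (metis Int_UN_distrib inf.absorb1)
    also have "\<dots> = 2 * (\<Sum>i. emeasure lborel (N \<inter> P i))"
      using P(1) by (subst suminf_emeasure) (auto simp: disjoint_family_on_def)
    also have "\<dots> = (\<Sum>i. 2 * emeasure lborel (N \<inter> P i))"
      by simp
    also have "\<dots> \<le> (\<Sum>i. emeasure lborel (P i))"
      by (intro suminf_le half) auto
    also have "\<dots> = emeasure lborel U"
      using P(1) UP by (subst suminf_emeasure) auto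
    also have "\<dots> = emeasure lborel N + emeasure lborel (U - N)"
      using U(2) by (subst plus_emeasure) (auto simp: Un_absorb1)
    finally have "2 * ennreal e \<le> ennreal e + emeasure lborel (U - N)"
      by (simp add: e)
    also have "\<dots> < ennreal e + ennreal e"
      using U(3) by (simp add: ennreal_add_left_cancel_less)
    finally show False
      by (simp add: mult_2)
  qed
  then show ?thesis
    using e by (simp add: N_def[symmetric] null_setsI)
qed

text \<open>
  Along the dyadic cubes that shrink to a point of \<open>E\<close>, the density of \<open>E\<close> starts at most at one
  half and, almost everywhere, exceeds one half at some generation \<open>m\<close>, taken minimal. In
  generation \<open>m - 1\<close> the density is still at most one half, but it is more than \<open>2 ^ - n\<close> times one
  half, because the child of generation \<open>m\<close> has \<open>2 ^ - n\<close> of the volume.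
\<close>

lemma balanced_cubes:
  fixes E :: "(real ^ 'n) set"
  assumes [measurable]: "E \<in> sets borel" and "L > 0" and EQ: "E \<subseteq> half_open_cube a L"
    and small: "2 * emeasure lborel E \<le> emeasure lborel (half_open_cube a L)"
  shows "\<exists>P. disjoint_family P \<and> E - (\<Union>i. P i) \<in> null_sets lborel
    \<and> (\<forall>i::nat. P i = {} \<or> (\<exists>b l. l > 0 \<and> P i = half_open_cube b l \<and> P i \<subseteq> half_open_cube a L
       \<and> emeasure lborel (E \<inter> P i) \<le> ennreal (l ^ CARD('n) / 2)
       \<and> ennreal (l ^ CARD('n) / 2 ^ (CARD('n) + 1)) \<le> emeasure lborel (E \<inter> P i)))"
proof -
  let ?n = "CARD('n)"
  let ?\<mu> = "emeasure lborel :: (real ^ 'n) set \<Rightarrow> ennreal"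
  define G where "G = {C. ?\<mu> C < 2 * ?\<mu> (E \<inter> C)}"
  define B where "B = {C. C \<subseteq> half_open_cube a L \<and> 2 * ?\<mu> (E \<inter> C) \<le> ?\<mu> C
    \<and> ?\<mu> C \<le> 2 ^ (?n + 1) * ?\<mu> (E \<inter> C)}"
  obtain P :: "nat \<Rightarrow> (real ^ 'n) set" where P: "disjoint_family P"
    "\<forall>i. P i = {} \<or> (\<exists>k x. P i = dyadic_cube a L k x \<and> dyadic_cube a L k x \<in> B)"
    "(\<Union>i. P i) = \<Union>{dyadic_cube a L k x | k x. dyadic_cube a L k x \<in> B}"
    using dyadic_disjoint_cover[of a L B] by blast
  have [measurable]: "P i \<in> sets borel" for i
    using P(2)[rule_format, of i] \<open>L > 0\<close> by auto
  have "emeasure lborel E \<noteq> \<infinity>"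
    using emeasure_mono[of E "half_open_cube a L" lborel] EQ \<open>L > 0\<close>
    by (auto simp: emeasure_half_open_cube top_unique)
  from null_set_outside_majority_cubes[OF assms(1) this \<open>L > 0\<close>]
  have "E - \<Union>{dyadic_cube a L k x | k x. dyadic_cube a L k x \<in> G} \<in> null_sets lborel"
    unfolding G_def .
  moreover have "E - (\<Union>i. P i) \<subseteq> E - \<Union>{dyadic_cube a L k x | k x. dyadic_cube a L k x \<in> G}"
  proof clarify
    fix x k y
    assume "x \<in> E" "x \<notin> (\<Union>i. P i)" and xy: "x \<in> dyadic_cube a L k y" "dyadic_cube a L k y \<in> G"
    have "dyadic_cube a L k x \<in> G"
      using xy by (simp add: dyadic_cube_eqI)
    define m where "m = (LEAST k. dyadic_cube a L k x \<in> G)"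
    have m: "dyadic_cube a L m x \<in> G"
      unfolding m_def by (rule LeastI) fact
    have zero: "dyadic_cube a L 0 x = half_open_cube a L"
      using \<open>x \<in> E\<close> EQ \<open>L > 0\<close> by (intro dyadic_cube_0) auto
    have "dyadic_cube a L 0 x \<notin> G"
      unfolding zero G_def using EQ small by (simp add: not_less Int_absorb2)
    with m obtain j where j: "m = Suc j" by (cases m) auto
    then have "dyadic_cube a L j x \<notin> G"
      using not_less_Least[of j "\<lambda>k. dyadic_cube a L k x \<in> G"] by (simp add: m_def)
    then have "2 * ?\<mu> (E \<inter> dyadic_cube a L j x) \<le> ?\<mu> (dyadic_cube a L j x)"
      by (simp add: G_def not_less)
    moreover have "dyadic_cube a L j x \<subseteq> half_open_cube a L"
      using dyadic_cube_antimono[of 0 j a L x] zero by simp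
    moreover have "?\<mu> (dyadic_cube a L j x) \<le> 2 ^ (?n + 1) * ?\<mu> (E \<inter> dyadic_cube a L j x)"
    proof -
      have "(L / 2 ^ j) ^ ?n = 2 ^ ?n * (L / 2 ^ m) ^ ?n"
        by (simp add: j power_mult_distrib[symmetric])
      then have "?\<mu> (dyadic_cube a L j x) = 2 ^ ?n * ?\<mu> (dyadic_cube a L m x)"
        using \<open>L > 0\<close> by (simp add: emeasure_dyadic_cube ennreal_mult ennreal_power[symmetric])
      also have "\<dots> \<le> 2 ^ ?n * (2 * ?\<mu> (E \<inter> dyadic_cube a L m x))"
        using m by (intro mult_left_mono) (auto simp: G_def)
      also have "\<dots> \<le> 2 ^ ?n * (2 * ?\<mu> (E \<inter> dyadic_cube a L j x))"
        using dyadic_cube_antimono[of j m a L x] \<open>L > 0\<close>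
        by (intro mult_left_mono emeasure_mono) (auto simp: j)
      finally show ?thesis
        by (simp add: mult_ac)
    qed
    ultimately have "dyadic_cube a L j x \<in> B"
      by (simp add: B_def)
    then have "x \<in> (\<Union>i. P i)"
      unfolding P(3) using dyadic_cube_self[of x a L j] by blast
    with \<open>x \<notin> (\<Union>i. P i)\<close> show False ..
  qed
  ultimately have "E - (\<Union>i. P i) \<in> null_sets lborel"
    using null_sets_subset[of _ lborel "E - (\<Union>i. P i)"] by simp
  moreover have "P i = {} \<or> (\<exists>b l. l > 0 \<and> P i = half_open_cube b l \<and> P i \<subseteq> half_open_cube a L
       \<and> ?\<mu> (E \<inter> P i) \<le> ennreal (l ^ ?n / 2)
       \<and> ennreal (l ^ ?n / 2 ^ (?n + 1)) \<le> ?\<mu> (E \<inter> P i))" for i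
  proof (cases "P i = {}")
    case False
    with P(2)[rule_format, of i] obtain k x where Pi: "P i = dyadic_cube a L k x" "P i \<in> B" by auto
    then have B: "P i \<subseteq> half_open_cube a L" "2 * ?\<mu> (E \<inter> P i) \<le> ?\<mu> (P i)"
      "?\<mu> (P i) \<le> 2 ^ (?n + 1) * ?\<mu> (E \<inter> P i)"
      by (auto simp: B_def)
    define l where "l = L / 2 ^ k"
    have "l > 0" using \<open>L > 0\<close> by (simp add: l_def)
    have \<mu>: "?\<mu> (P i) = ennreal (l ^ ?n)"
      unfolding Pi l_def using \<open>L > 0\<close> by (simp add: emeasure_dyadic_cube)
    have "?\<mu> (E \<inter> P i) \<le> ?\<mu> (P i)"
      by (rule emeasure_mono) auto
    then obtain t where t: "?\<mu> (E \<inter> P i) = ennreal t" "t \<ge> 0"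
      by (cases "?\<mu> (E \<inter> P i)") (auto simp: \<mu> top_unique)
    have "2 * t \<le> l ^ ?n"
    proof -
      have "2 * ennreal t = ennreal (2 * t)"
        by (simp add: ennreal_mult t)
      then show ?thesis
        using B(2) \<open>l > 0\<close> unfolding \<mu> t(1) by (simp only: ennreal_le_iff zero_le_power less_imp_le)
    qed
    moreover have "l ^ ?n \<le> 2 ^ (?n + 1) * t"
    proof -
      have "2 ^ (?n + 1) * ennreal t = ennreal (2 ^ (?n + 1) * t)"
        by (simp add: ennreal_mult t ennreal_power[symmetric] del: power_Suc)
      then show ?thesis
        using B(3) t(2) unfolding \<mu> t(1) by (simp only: ennreal_le_iff mult_nonneg_nonneg
            zero_le_power zero_le_numeral)
    qed
    ultimately have "?\<mu> (E \<inter> P i) \<le> ennreal (l ^ ?n / 2)"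
      "ennreal (l ^ ?n / 2 ^ (?n + 1)) \<le> ?\<mu> (E \<inter> P i)"
      unfolding t(1) by (auto intro!: ennreal_leI simp: field_simps)
    moreover obtain b where "P i = half_open_cube b l"
      unfolding Pi l_def dyadic_cube_is_half_open_cube[OF \<open>L > 0\<close>] by blast
    ultimately show ?thesis
      using B(1) \<open>l > 0\<close> by blast
  qed simp
  ultimately show ?thesis
    using P(1) by blast
qed

section \<open>Sums of powers, weights and the maximal function\<close>

lemma ennreal_powr_mono:
  assumes "s \<le> t" "0 \<le> a"
  shows "ennreal_powr s a \<le> ennreal_powr t a"
proof (cases "t = \<infinity>")
  case False
  then have "s \<noteq> \<infinity>" using assms(1) by (auto simp: top_unique)
  then show ?thesis
    using False assms by (auto simp: ennreal_powr_def less_top intro!: ennreal_leI powr_mono2 enn2real_mono)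
qed (simp add: ennreal_powr_def)

text \<open>
  If \<open>s\<close> is the sum, each term satisfies \<open>f i powr q \<le> f i * s powr (q - 1)\<close>, as \<open>f i \<le> s\<close>.
\<close>

lemma suminf_ennreal_powr_le:
  assumes "1 \<le> q"
  shows "(\<Sum>i. ennreal_powr (f i) q) \<le> ennreal_powr (\<Sum>i. f i) q"
proof (cases "(\<Sum>i. f i) = \<infinity>")
  case False
  then obtain s where s: "(\<Sum>i. f i) = ennreal s" "s \<ge> 0"
    by (cases "\<Sum>i. f i") auto
  have "ennreal_powr (f i) q \<le> f i * ennreal (s powr (q - 1))" for i
  proof -
    have "f i \<le> (\<Sum>i. f i)"
      using sum_le_suminf[of f "{i}"] by simp
    then obtain r where r: "f i = ennreal r" "0 \<le> r" "r \<le> s"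
      using s by (cases "f i") (auto simp: top_unique)
    have "r powr q = r * r powr (q - 1)"
      using r(2) assms by (cases "r = 0") (auto simp: powr_diff)
    also have "\<dots> \<le> r * s powr (q - 1)"
      using r assms by (intro mult_left_mono powr_mono2) auto
    finally show ?thesis
      using r by (simp add: ennreal_powr_def ennreal_mult[symmetric] ennreal_leI)
  qed
  then have "(\<Sum>i. ennreal_powr (f i) q) \<le> (\<Sum>i. f i * ennreal (s powr (q - 1)))"
    by (intro suminf_le) auto
  also have "\<dots> = ennreal (s * s powr (q - 1))"
    using s by (simp add: ennreal_mult)
  also have "\<dots> = ennreal_powr (\<Sum>i. f i) q"
    using s assms by (cases "s = 0") (auto simp: ennreal_powr_def powr_diff)
  finally show ?thesis .
qed (simp add: ennreal_powr_def)

text \<open>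
  The integrability of a weight over compact sets gives its measurability locally; this form
  restricts it to a bounded set and avoids patching the pieces together.
\<close>

lemma weight_restricted:
  fixes w :: "real ^ 'n \<Rightarrow> real"
  assumes "is_weight w" "bounded S" "S \<in> sets lebesgue"
  shows weight_restricted_measurable: "(\<lambda>x. ennreal (w x) * indicator S x) \<in> borel_measurable lebesgue"
    and weight_of_finite: "weight_of w S < \<infinity>"
proof -
  obtain a b where ab: "S \<subseteq> cbox a b"
    using assms(2) bounded_subset_cbox_symmetric by blast
  have int: "integrable lebesgue (\<lambda>x. indicator (cbox a b) x *\<^sub>R w x)"
    using assms(1) compact_cbox[of a b] by (auto simp: is_weight_def set_integrable_def)
  note [measurable] = borel_measurable_integrable[OF int] assms(3)
  have eq: "(\<lambda>x. ennreal (w x) * indicator S x)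
      = (\<lambda>x. ennreal (indicator (cbox a b) x *\<^sub>R w x) * indicator S x)"
    using ab by (auto simp: fun_eq_iff split: split_indicator)
  show "(\<lambda>x. ennreal (w x) * indicator S x) \<in> borel_measurable lebesgue"
    unfolding eq by measurable
  have "weight_of w S \<le> (\<integral>\<^sup>+x. ennreal (norm (indicator (cbox a b) x *\<^sub>R w x)) \<partial>lebesgue)"
    unfolding weight_of_def eq by (intro nn_integral_mono) (auto intro!: ennreal_leI split: split_indicator)
  also have "\<dots> < \<infinity>"
    using int by (simp only: integrable_iff_bounded)
  finally show "weight_of w S < \<infinity>" .
qed

lemma weight_le_maximal_fun:
  assumes "is_cube P" "x \<in> P"
  shows "weight_of w P / emeasure lebesgue P \<le> maximal_fun w x"
proof -
  have "weight_of w P \<le> (\<integral>\<^sup>+y\<in>P. ennreal \<bar>w y\<bar> \<partial>lebesgue)"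
    unfolding weight_of_def by (intro nn_integral_mono mult_right_mono ennreal_leI) auto
  then show ?thesis
    unfolding maximal_fun_def using assms
    by (intro SUP_upper2[of P]) (auto intro!: divide_right_mono_ennreal)
qed

definition maximal_energy :: "(real ^ 'n \<Rightarrow> real) \<Rightarrow> real \<Rightarrow> (real ^ 'n) set \<Rightarrow> (real ^ 'n) set \<Rightarrow> ennreal" where
  "maximal_energy w \<epsilon> A B =
    (\<integral>\<^sup>+x\<in>A. (\<integral>\<^sup>+y\<in>B.
        ennreal_powr (maximal_fun w x) ((real CARD('n) - 1 + \<epsilon>) / real CARD('n))
          / ennreal (dist x y powr (real CARD('n) + 1 - \<epsilon>)) \<partial>lebesgue) \<partial>lebesgue)"

text \<open>
  Take \<open>v = (w(P) / l ^ n) powr p\<close>. Since \<open>n * p = n - 1 + \<epsilon>\<close>, the power of \<open>l\<close> on the left of the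
  isoperimetric inequality turns \<open>v\<close> into \<open>w(P) powr p\<close>. The constant \<open>v\<close> stands below the maximal
  function on \<open>P\<close>, so that later integrals have measurable integrands.
\<close>

lemma weight_half_open_cube_le:
  fixes w :: "real ^ 'n \<Rightarrow> real"
  assumes w: "is_weight w" and "0 < \<epsilon>" "\<epsilon> \<le> 1" and [measurable]: "E \<in> sets borel"
    and "l > 0" and P: "P = half_open_cube b l"
    and upper: "emeasure lborel (E \<inter> P) \<le> ennreal (l ^ CARD('n) / 2)"
    and lower: "ennreal (l ^ CARD('n) / 2 ^ (CARD('n) + 1)) \<le> emeasure lborel (E \<inter> P)"
  defines "p \<equiv> (real CARD('n) - 1 + \<epsilon>) / real CARD('n)"
  obtains v where "v \<ge> 0" "\<And>x. x \<in> P \<Longrightarrow> ennreal v \<le> ennreal_powr (maximal_fun w x) p"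
    "ennreal (enn2real (weight_of w P) powr p) \<le> ennreal (isoperimetric_constant CARD('n) * \<epsilon>)
      * (ennreal v * interaction (\<lambda>t. ennreal (t powr - (real CARD('n) + 1 - \<epsilon>))) (E \<inter> P) (P - E))"
proof
  let ?n = "CARD('n)"
  have "P \<in> sets borel" "bounded P" using P bounded_half_open_cube by auto
  define \<omega> where "\<omega> = enn2real (weight_of w P)"
  have \<omega>: "weight_of w P = ennreal \<omega>" "\<omega> \<ge> 0"
    using weight_of_finite[OF w \<open>bounded P\<close>] \<open>P \<in> sets borel\<close> by (auto simp: \<omega>_def)
  have "0 \<le> p" using \<open>0 < \<epsilon>\<close> by (auto simp: p_def Suc_le_eq intro!: divide_nonneg_nonneg)
  define v where "v = (\<omega> / l ^ ?n) powr p"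
  show "v \<ge> 0" by (simp add: v_def)
  show "ennreal v \<le> ennreal_powr (maximal_fun w x) p" if "x \<in> P" for x
  proof -
    have "ennreal (\<omega> / l ^ ?n) = weight_of w P / emeasure lebesgue P"
      using \<open>l > 0\<close> \<omega> by (simp add: P emeasure_half_open_cube divide_ennreal)
    also have "\<dots> \<le> maximal_fun w x"
      using is_cube_half_open_cube[OF \<open>l > 0\<close>, of b] that by (intro weight_le_maximal_fun) (auto simp: P)
    finally have "ennreal_powr (ennreal (\<omega> / l ^ ?n)) p \<le> ennreal_powr (maximal_fun w x) p"
      by (rule ennreal_powr_mono) fact
    then show ?thesis
      using \<omega>(2) \<open>l > 0\<close> by (simp add: ennreal_powr_def v_def)
  qed
  have iso: "ennreal (l powr (real ?n - 1 + \<epsilon>)) \<le> ennreal (isoperimetric_constant ?n * \<epsilon>)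
      * interaction (\<lambda>t. ennreal (t powr - (real ?n + 1 - \<epsilon>))) (E \<inter> P) (P - E)"
    using upper lower \<open>l > 0\<close> assms(2,3) \<open>P \<in> sets borel\<close>
    by (intro fractional_isoperimetric_cube[where a=b]) (auto simp: P)
  have "\<omega> powr p = v * l powr (real ?n - 1 + \<epsilon>)"
    using \<omega>(2) \<open>l > 0\<close>
    by (simp add: v_def p_def powr_divide powr_realpow[symmetric] powr_powr)
  then have "ennreal (\<omega> powr p) = ennreal v * ennreal (l powr (real ?n - 1 + \<epsilon>))"
    using \<open>v \<ge> 0\<close> by (simp add: ennreal_mult)
  also have "\<dots> \<le> ennreal v * (ennreal (isoperimetric_constant ?n * \<epsilon>)
      * interaction (\<lambda>t. ennreal (t powr - (real ?n + 1 - \<epsilon>))) (E \<inter> P) (P - E))"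
    by (intro mult_left_mono iso) simp
  finally show "ennreal (enn2real (weight_of w P) powr p) \<le> ennreal (isoperimetric_constant ?n * \<epsilon>)
      * (ennreal v * interaction (\<lambda>t. ennreal (t powr - (real ?n + 1 - \<epsilon>))) (E \<inter> P) (P - E))"
    by (simp add: \<omega>_def mult.left_commute)
qed

text \<open>
  Summation over the balanced cubes: the weights are summed through the \<open>q\<close>-th power, and the
  local energies, being supported on disjoint sets of \<open>x\<close>, under a single outer integral. In
  place of the maximal function its constant minorants \<open>v i\<close> are summed, because the exchange of
  sum and integral calls for measurable integrands.
\<close>

lemma weight_le_maximal_energy_half_open:
  fixes w :: "real ^ 'n \<Rightarrow> real"
  assumes w: "is_weight w" and \<epsilon>: "0 < \<epsilon>" "\<epsilon> \<le> 1" and [measurable]: "E \<in> sets borel"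
    and "L > 0" and EQ: "E \<subseteq> half_open_cube a L"
    and small: "2 * emeasure lborel E \<le> emeasure lborel (half_open_cube a L)"
  shows "weight_of w E \<le> ennreal_powr
      (ennreal (isoperimetric_constant CARD('n) * \<epsilon>) * maximal_energy w \<epsilon> E (half_open_cube a L - E))
      (real CARD('n) / (real CARD('n) - 1 + \<epsilon>))"
proof -
  let ?n = "CARD('n)"
  let ?Q = "half_open_cube a L"
  define p where "p = (real ?n - 1 + \<epsilon>) / real ?n"
  define q where "q = real ?n / (real ?n - 1 + \<epsilon>)"
  have "real ?n \<ge> 1" by (simp add: Suc_le_eq)
  then have "real ?n - 1 + \<epsilon> > 0" "real ?n > 0" using \<epsilon> by linarith+
  then have "p * q = 1" "1 \<le> q"
    using \<epsilon> by (auto simp: p_def q_def le_divide_eq)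
  define a' where "a' = real ?n + 1 - \<epsilon>"
  define c where "c = ennreal (isoperimetric_constant ?n * \<epsilon>)"
  define k where "k = (\<lambda>t. ennreal (t powr - a'))"
  have [measurable]: "k \<in> borel_measurable borel"
    unfolding k_def by measurable
  obtain P :: "nat \<Rightarrow> (real ^ 'n) set" where P: "disjoint_family P" "E - (\<Union>i. P i) \<in> null_sets lborel"
    "\<forall>i. P i = {} \<or> (\<exists>b l. l > 0 \<and> P i = half_open_cube b l \<and> P i \<subseteq> ?Q
       \<and> emeasure lborel (E \<inter> P i) \<le> ennreal (l ^ ?n / 2)
       \<and> ennreal (l ^ ?n / 2 ^ (?n + 1)) \<le> emeasure lborel (E \<inter> P i))"
    using balanced_cubes[OF assms(4,5) EQ small] by blast
  have PQ: "P i \<subseteq> ?Q" for i using P(3)[rule_format, of i] by auto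
  have PB [measurable]: "P i \<in> sets borel" for i
    using P(3)[rule_format, of i] by auto
  define \<omega> where "\<omega> i = enn2real (weight_of w (P i))" for i
  have bP: "bounded (P i)" for i
    using bounded_subset[OF bounded_half_open_cube PQ] .
  have \<omega>: "weight_of w (P i) = ennreal (\<omega> i)" "\<omega> i \<ge> 0" for i
    using weight_of_finite[OF w bP] PB by (auto simp: \<omega>_def)
  have "\<exists>v. v \<ge> 0 \<and> (\<forall>x\<in>P i. ennreal v \<le> ennreal_powr (maximal_fun w x) p)
      \<and> ennreal (\<omega> i powr p) \<le> c * (ennreal v * interaction k (E \<inter> P i) (P i - E))" for i
  proof (cases "P i = {}")
    case True
    then show ?thesis
      by (intro exI[of _ 0]) (auto simp: \<omega>_def weight_of_def)
  next
    case False
    then obtain b l where bl: "l > 0" "P i = half_open_cube b l"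
      "emeasure lborel (E \<inter> P i) \<le> ennreal (l ^ ?n / 2)"
      "ennreal (l ^ ?n / 2 ^ (?n + 1)) \<le> emeasure lborel (E \<inter> P i)"
      using P(3) by blast
    show ?thesis
      by (rule weight_half_open_cube_le[OF w \<epsilon> assms(4) bl])
        (auto simp: p_def c_def k_def a'_def \<omega>_def)
  qed
  then obtain v where v: "\<And>i. v i \<ge> 0" "\<And>i x. x \<in> P i \<Longrightarrow> ennreal (v i) \<le> ennreal_powr (maximal_fun w x) p"
    "\<And>i. ennreal (\<omega> i powr p) \<le> c * (ennreal (v i) * interaction k (E \<inter> P i) (P i - E))"
    by metis
  have "weight_of w E \<le> (\<integral>\<^sup>+x. (\<Sum>i. ennreal (w x) * indicator (P i) x) \<partial>lebesgue)"
    unfolding weight_of_def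
  proof (rule nn_integral_mono_AE)
    have "AE x in lebesgue. x \<notin> E - (\<Union>i. P i)"
      by (rule AE_not_in[OF null_sets_completionI[OF P(2)]])
    then show "AE x in lebesgue. ennreal (w x) * indicator E x \<le> (\<Sum>i. ennreal (w x) * indicator (P i) x)"
    proof eventually_elim
      case (elim x)
      then show ?case
        using P(1) by (auto simp: suminf_indicator split: split_indicator)
    qed
  qed
  also have "\<dots> = (\<Sum>i. weight_of w (P i))"
    unfolding weight_of_def
    using weight_restricted_measurable[OF w bP] PB by (intro nn_integral_suminf) auto
  also have "\<dots> = (\<Sum>i. ennreal_powr (ennreal (\<omega> i powr p)) q)"
    using \<open>p * q = 1\<close> \<omega> by (simp add: ennreal_powr_def powr_powr)
  also have "\<dots> \<le> ennreal_powr (\<Sum>i. ennreal (\<omega> i powr p)) q"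
    by (rule suminf_ennreal_powr_le) fact
  also have "\<dots> \<le> ennreal_powr (c * maximal_energy w \<epsilon> E (?Q - E)) q"
  proof (rule ennreal_powr_mono)
    define g where "g i x = ennreal (v i) * (\<integral>\<^sup>+y\<in>P i - E. k (dist x y) \<partial>lborel)" for i x
    have [measurable]: "g i \<in> borel_measurable borel" for i
      unfolding g_def by measurable
    have "(\<Sum>i. \<integral>\<^sup>+x. g i x * indicator (E \<inter> P i) x \<partial>lborel)
        = (\<integral>\<^sup>+x. (\<Sum>i. g i x * indicator (E \<inter> P i) x) \<partial>lborel)"
      by (rule nn_integral_suminf[symmetric]) measurable
    also have "\<dots> \<le> maximal_energy w \<epsilon> E (?Q - E)"
      unfolding maximal_energy_def nn_integral_completion p_def[symmetric] a'_def[symmetric]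
    proof (rule nn_integral_mono)
      fix x
      let ?G = "\<integral>\<^sup>+y\<in>?Q - E. ennreal_powr (maximal_fun w x) p / ennreal (dist x y powr a') \<partial>lborel"
      have "g i x * indicator (E \<inter> P i) x \<le> (?G * indicator E x) * indicator (P i) x" for i
      proof (cases "x \<in> E \<inter> P i")
        case True
        have "g i x = (\<integral>\<^sup>+y\<in>P i - E. ennreal (v i) * k (dist x y) \<partial>lborel)"
          unfolding g_def by (simp add: nn_integral_cmult mult.assoc)
        also have "\<dots> \<le> ?G"
        proof (rule nn_integral_mono)
          fix y
          have "ennreal (v i) * k (dist x y) \<le> ennreal_powr (maximal_fun w x) p / ennreal (dist x y powr a')"
            if "y \<in> P i - E"
          proof -
            have "dist x y > 0" using that True by auto
            then have "k (dist x y) = inverse (ennreal (dist x y powr a'))"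
              by (simp add: k_def powr_minus inverse_ennreal)
            then show ?thesis
              using v(2)[of x i] True by (simp add: divide_ennreal_def mult_right_mono)
          qed
          then show "ennreal (v i) * k (dist x y) * indicator (P i - E) y
              \<le> ennreal_powr (maximal_fun w x) p / ennreal (dist x y powr a') * indicator (?Q - E) y"
            using PQ[of i] by (auto split: split_indicator)
        qed
        finally show ?thesis using True by simp
      qed auto
      then have "(\<Sum>i. g i x * indicator (E \<inter> P i) x) \<le> (\<Sum>i. (?G * indicator E x) * indicator (P i) x)"
        by (intro suminf_le) auto
      also have "\<dots> = (?G * indicator E x) * indicator (\<Union>i. P i) x"
        using P(1) by (simp add: suminf_indicator)
      also have "\<dots> \<le> ?G * indicator E x"
        by (auto split: split_indicator)
      finally show "(\<Sum>i. g i x * indicator (E \<inter> P i) x) \<le> ?G * indicator E x" .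
    qed
    finally have sum_g: "(\<Sum>i. \<integral>\<^sup>+x. g i x * indicator (E \<inter> P i) x \<partial>lborel)
        \<le> maximal_energy w \<epsilon> E (?Q - E)" .
    have "(\<Sum>i. ennreal (\<omega> i powr p)) \<le> (\<Sum>i. c * (ennreal (v i) * interaction k (E \<inter> P i) (P i - E)))"
      by (intro suminf_le v) auto
    also have "\<dots> = c * (\<Sum>i. \<integral>\<^sup>+x. g i x * indicator (E \<inter> P i) x \<partial>lborel)"
      unfolding interaction_def g_def by (simp add: nn_integral_cmult mult.assoc)
    also have "\<dots> \<le> c * maximal_energy w \<epsilon> E (?Q - E)"
      by (intro mult_left_mono sum_g) simp
    finally show "(\<Sum>i. ennreal (\<omega> i powr p)) \<le> c * maximal_energy w \<epsilon> E (?Q - E)" .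
  qed (use \<open>1 \<le> q\<close> in auto)
  finally show ?thesis
    unfolding c_def q_def .
qed

section \<open>Arbitrary cubes and Lebesgue measurable sets\<close>

text \<open>
  Both sides are unchanged when \<open>Q\<close> is replaced by a half-open cube and \<open>E\<close> by a Borel subset of
  it that differs from \<open>E\<close> by a null set.
\<close>

lemma weight_le_maximal_energy:
  fixes w :: "real ^ 'n \<Rightarrow> real"
  assumes w: "is_weight w" and \<epsilon>: "0 < \<epsilon>" "\<epsilon> \<le> 1" and Q: "is_cube Q"
    and E: "E \<in> sets lebesgue" "E \<subseteq> Q"
    and small: "2 * emeasure lebesgue E \<le> emeasure lebesgue Q"
  shows "weight_of w E \<le> ennreal_powr
      (ennreal (isoperimetric_constant CARD('n) * \<epsilon>) * maximal_energy w \<epsilon> E (Q - E))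
      (real CARD('n) / (real CARD('n) - 1 + \<epsilon>))"
proof -
  obtain a L where L: "L > 0" and sandwich: "box a (a + (\<chi> i. L)) \<subseteq> Q" "Q \<subseteq> cbox a (a + (\<chi> i. L))"
    by (rule is_cube_sandwich[OF Q])
  define H where "H = half_open_cube a L"
  have H: "box a (a + (\<chi> i. L)) \<subseteq> H" "H \<subseteq> cbox a (a + (\<chi> i. L))"
    by (auto simp: H_def half_open_cube_def mem_box_cart less_imp_le)
  have frontier: "cbox a (a + (\<chi> i. L)) - box a (a + (\<chi> i. L)) \<in> null_sets lebesgue"
    using negligible_frontier_interval by (simp add: negligible_iff_null_sets)
  obtain S N N' where S: "E = S \<union> N" "N \<subseteq> N'" "N' \<in> null_sets lborel" "S \<in> sets lborel"
    using E(1) by (rule sets_completionE)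
  have "N' \<in> null_sets lebesgue" using S(3) by (rule null_sets_completionI)
  define F where "F = S \<inter> H"
  have F: "F \<in> sets borel" "F \<subseteq> H" "F \<subseteq> E"
    using S by (auto simp: F_def H_def)
  have ae: "AE x in lebesgue. (x \<in> H \<longleftrightarrow> x \<in> Q) \<and> (x \<in> F \<longleftrightarrow> x \<in> E)"
    using AE_not_in[OF frontier] AE_not_in[OF \<open>N' \<in> null_sets lebesgue\<close>]
  proof eventually_elim
    case (elim x)
    then have "x \<in> H \<longleftrightarrow> x \<in> Q" using H sandwich by blast
    moreover have "x \<in> F \<longleftrightarrow> x \<in> E"
      using elim S \<open>x \<in> H \<longleftrightarrow> x \<in> Q\<close> E(2) by (auto simp: F_def)
    ultimately show ?case ..
  qed
  have "weight_of w E \<le> weight_of w F"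
    unfolding weight_of_def
  proof (rule nn_integral_mono_AE)
    show "AE x in lebesgue. ennreal (w x) * indicator E x \<le> ennreal (w x) * indicator F x"
      using ae by eventually_elim (auto split: split_indicator)
  qed
  also have "\<dots> \<le> ennreal_powr
      (ennreal (isoperimetric_constant CARD('n) * \<epsilon>) * maximal_energy w \<epsilon> F (H - F))
      (real CARD('n) / (real CARD('n) - 1 + \<epsilon>))"
    unfolding H_def
  proof (rule weight_le_maximal_energy_half_open[OF w \<epsilon>])
    have "emeasure lborel F = emeasure lebesgue F"
      using F(1) by simp
    also have "\<dots> \<le> emeasure lebesgue E"
      using F(3) E(1) by (rule emeasure_mono)
    finally have "2 * emeasure lborel F \<le> 2 * emeasure lebesgue E"
      by (intro mult_left_mono) auto
    also have "\<dots> \<le> emeasure lborel (half_open_cube a L)"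
      using small emeasure_between_box_cbox[OF sandwich] emeasure_between_box_cbox[OF H]
      by (simp add: H_def)
    finally show "2 * emeasure lborel F \<le> emeasure lborel (half_open_cube a L)" .
  qed (use F L in \<open>auto simp: H_def\<close>)
  also have "\<dots> \<le> ennreal_powr
      (ennreal (isoperimetric_constant CARD('n) * \<epsilon>) * maximal_energy w \<epsilon> E (Q - E))
      (real CARD('n) / (real CARD('n) - 1 + \<epsilon>))"
  proof (intro ennreal_powr_mono mult_left_mono)
    show "maximal_energy w \<epsilon> F (H - F) \<le> maximal_energy w \<epsilon> E (Q - E)"
      unfolding maximal_energy_def
    proof (rule nn_integral_mono)
      fix x
      let ?h = "\<lambda>y. ennreal_powr (maximal_fun w x) ((real CARD('n) - 1 + \<epsilon>) / real CARD('n))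
          / ennreal (dist x y powr (real CARD('n) + 1 - \<epsilon>))"
      have "(\<integral>\<^sup>+y\<in>H - F. ?h y \<partial>lebesgue) \<le> (\<integral>\<^sup>+y\<in>Q - E. ?h y \<partial>lebesgue)"
      proof (rule nn_integral_mono_AE)
        show "AE y in lebesgue. ?h y * indicator (H - F) y \<le> ?h y * indicator (Q - E) y"
          using ae by eventually_elim (auto split: split_indicator)
      qed
      then show "(\<integral>\<^sup>+y\<in>H - F. ?h y \<partial>lebesgue) * indicator F x
          \<le> (\<integral>\<^sup>+y\<in>Q - E. ?h y \<partial>lebesgue) * indicator E x"
        using F(3) by (auto split: split_indicator)
    qed
  qed (use \<epsilon> in \<open>auto intro!: divide_nonneg_nonneg simp: Suc_le_eq\<close>)
  finally show ?thesis .
qed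

lemma weight_product_le_maximal_energy:
  fixes w :: "real ^ 'n \<Rightarrow> real"
  assumes w: "is_weight w" and \<epsilon>: "0 < \<epsilon>" "\<epsilon> \<le> 1" and Q: "is_cube Q"
    and E: "E \<in> sets lebesgue" "E \<subseteq> Q"
  shows "weight_of w (Q - E) * weight_of w E \<le> weight_of w Q * ennreal_powr
      (ennreal (isoperimetric_constant CARD('n) * \<epsilon>) * maximal_energy w \<epsilon> E (Q - E)
       + ennreal (isoperimetric_constant CARD('n) * \<epsilon>) * maximal_energy w \<epsilon> (Q - E) E)
      (real CARD('n) / (real CARD('n) - 1 + \<epsilon>))"
proof -
  define c where "c = ennreal (isoperimetric_constant CARD('n) * \<epsilon>)"
  define q where "q = real CARD('n) / (real CARD('n) - 1 + \<epsilon>)"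
  have "q \<ge> 0" using \<epsilon> by (auto simp: q_def Suc_le_eq intro!: divide_nonneg_nonneg)
  have QE: "Q - E \<in> sets lebesgue" "Q - (Q - E) = E"
    using sets_lebesgue_is_cube[OF Q] E by auto
  let ?X = "ennreal_powr (c * maximal_energy w \<epsilon> E (Q - E) + c * maximal_energy w \<epsilon> (Q - E) E) q"
  have mono: "weight_of w A \<le> weight_of w Q" if "A \<subseteq> Q" for A
    unfolding weight_of_def using that by (intro nn_integral_mono) (auto split: split_indicator)
  have "emeasure lebesgue Q = emeasure lebesgue E + emeasure lebesgue (Q - E)"
    using E QE by (subst plus_emeasure) (auto simp: Un_absorb1)
  then consider "2 * emeasure lebesgue E \<le> emeasure lebesgue Q"
    | "2 * emeasure lebesgue (Q - E) \<le> emeasure lebesgue Q"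
    unfolding mult_2
    by (cases "emeasure lebesgue E \<le> emeasure lebesgue (Q - E)") (simp_all add: add_left_mono add_right_mono)
  then have "weight_of w (Q - E) * weight_of w E \<le> weight_of w Q * ?X"
  proof cases
    case 1
    have "weight_of w E \<le> ennreal_powr (c * maximal_energy w \<epsilon> E (Q - E)) q"
      unfolding c_def q_def using weight_le_maximal_energy[OF w \<epsilon> Q E 1] .
    also have "\<dots> \<le> ?X"
      using \<open>q \<ge> 0\<close> by (intro ennreal_powr_mono) auto
    finally show ?thesis
      by (intro mult_mono mono) auto
  next
    case 2
    have "weight_of w (Q - E) \<le> ennreal_powr (c * maximal_energy w \<epsilon> (Q - E) E) q"
      unfolding c_def q_def
      using weight_le_maximal_energy[OF w \<epsilon> Q QE(1) _ 2] by (simp add: QE(2))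
    also have "\<dots> \<le> ?X"
      using \<open>q \<ge> 0\<close> by (intro ennreal_powr_mono) auto
    finally have "weight_of w E * weight_of w (Q - E) \<le> weight_of w Q * ?X"
      using E(2) by (intro mult_mono mono) auto
    then show ?thesis by (simp add: mult.commute)
  qed
  then show ?thesis
    unfolding c_def q_def .
qed

theorem corollary2p13:
  shows "\<exists>c::real. c > 0 \<and>
    (\<forall>(Q :: (real ^ 'n) set) E (w :: real ^ 'n \<Rightarrow> real) (\<epsilon>::real).
       is_cube Q \<longrightarrow> E \<in> sets lebesgue \<longrightarrow> E \<subseteq> Q \<longrightarrow> is_weight w \<longrightarrow> 0 < \<epsilon> \<longrightarrow> \<epsilon> \<le> 1 / 2 \<longrightarrow>
       weight_of w (Q - E) * weight_of w E
       \<le> weight_of w Q *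
          ennreal_powr
            (ennreal (c * \<epsilon>) *
               (\<integral>\<^sup>+x\<in>E. (\<integral>\<^sup>+y\<in>Q - E.
                  ennreal_powr (maximal_fun w x) ((real CARD('n) - 1 + \<epsilon>) / real CARD('n))
                    / ennreal (dist x y powr (real CARD('n) + 1 - \<epsilon>)) \<partial>lebesgue) \<partial>lebesgue)
             + ennreal (c * \<epsilon>) *
               (\<integral>\<^sup>+x\<in>Q - E. (\<integral>\<^sup>+y\<in>E.
                  ennreal_powr (maximal_fun w x) ((real CARD('n) - 1 + \<epsilon>) / real CARD('n))
                    / ennreal (dist x y powr (real CARD('n) + 1 - \<epsilon>)) \<partial>lebesgue) \<partial>lebesgue))
            (real CARD('n) / (real CARD('n) - 1 + \<epsilon>)))"
proof (intro exI[of _ "isoperimetric_constant CARD('n)"] conjI allI impI)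
  show "isoperimetric_constant CARD('n) > 0"
    by (simp add: isoperimetric_constant_def)
qed (rule weight_product_le_maximal_energy[unfolded maximal_energy_def], auto)

end
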